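(* Let $\Delta^-=\{[a:b:c:d]\in\mathbb{RP}^3\mid \Delta_3(a,b,c,d)<0\}$ be the set of (scaling classes of) real cubics with exactly one real root, where $\Delta_3$ is the discriminant of the binary cubic $ax^3+bx^2y+cxy^2+dy^3$, and let $\mathcal{R}(\Delta^-)=\{\{r,z,\overline z\}\mid r\in\mathbb{RP}^1,\ z\in\mathbb{C}\setminus\mathbb{R}\}$ be the set of their root-sets. Each of these spaces admits a natural $\mathrm{PSL}(2;\mathbb{R})$ action: on $\Delta^-$, $A\cdot[f]=[f\circ A^{-1}]$ (precomposing the cubic form with a linear transformation), and on $\mathcal{R}(\Delta^-)$, $A\cdot\{r,z,\overline z\}=\{A.r,A.z,A.\overline z\}$ (applying the Möbius transformation to each root). Equipped with these actions, each of these spaces is isomorphic to the unit tangent bundle $\mathrm{UT}\mathbb{H}^2$ of the hyperbolic plane with its natural $\mathrm{PSL}(2;\mathbb{R})$ action.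
   Context: Roots of binary cubic forms are taken in $\mathbb{CP}^1=\mathbb{C}\cup\{\infty\}$, with $[x:y]=[z:1]$ corresponding to $z\in\mathbb{C}$ and $[1:0]$ to $\infty$; $\mathbb{RP}^1=\mathbb{R}\cup\{\infty\}\subset\mathbb{CP}^1$. $\Delta_3(a,b,c,d)=b^2c^2-4ac^3-4b^3d-27a^2d^2+18abcd$. $\Delta^-$ has the topology of a subset of $\mathbb{RP}^3$; $\mathcal{R}(\Delta^-)$ has the topology of a subset of the symmetric power $\mathrm{SP}^3(\mathbb{CP}^1)=(\mathbb{CP}^1)^3/S_3$. $\mathrm{UT}\mathbb{H}^2=\{(p,v)\mid p\in\mathbb{H}^2,\ v\in T_p\mathbb{H}^2,\ \|v\|=1\}$, where $\mathbb{H}^2$ is the upper half plane with metric $(dx^2+dy^2)/y^2$, and $\mathrm{PSL}(2;\mathbb{R})$ acts on $\mathrm{UT}\mathbb{H}^2$ by the differential of its action on $\mathbb{H}^2$ by Möbius isometries. Spaces with $\mathrm{PSL}(2;\mathbb{R})$ actions are "isomorphic" (as geometries in the sense of Klein) if there is a $\mathrm{PSL}(2;\mathbb{R})$-equivariant homeomorphism between them. *)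

theory Defs
  imports "HOL-Analysis.Analysis" "HOL-Algebra.Group_Action"
begin

section \<open>Quotient topologies and projective spaces\<close>

definition quotient_topology :: "'a topology \<Rightarrow> ('a \<Rightarrow> 'b) \<Rightarrow> 'b topology" where
  "quotient_topology X q =
     topology (\<lambda>U. U \<subseteq> q ` topspace X \<and> openin X {x \<in> topspace X. q x \<in> U})"

lemma openin_quotient_topology:
  "openin (quotient_topology X q) U \<longleftrightarrow>
     U \<subseteq> q ` topspace X \<and> openin X {x \<in> topspace X. q x \<in> U}"
proof -
  have "istopology (\<lambda>U. U \<subseteq> q ` topspace X \<and> openin X {x \<in> topspace X. q x \<in> U})"
    unfolding istopology_def
  proof (intro conjI allI impI)
    fix S T
    assume S: "S \<subseteq> q ` topspace X \<and> openin X {x \<in> topspace X. q x \<in> S}"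
      and T: "T \<subseteq> q ` topspace X \<and> openin X {x \<in> topspace X. q x \<in> T}"
    have "{x \<in> topspace X. q x \<in> S \<inter> T} =
        {x \<in> topspace X. q x \<in> S} \<inter> {x \<in> topspace X. q x \<in> T}"
      by auto
    with S T show "openin X {x \<in> topspace X. q x \<in> S \<inter> T}"
      by (simp only: openin_Int)
  next
    fix K
    assume K: "\<forall>U\<in>K. U \<subseteq> q ` topspace X \<and> openin X {x \<in> topspace X. q x \<in> U}"
    have "{x \<in> topspace X. q x \<in> \<Union>K} = (\<Union>U\<in>K. {x \<in> topspace X. q x \<in> U})"
      by auto
    moreover have "openin X (\<Union>U\<in>K. {x \<in> topspace X. q x \<in> U})"
      using K by (intro openin_Union) auto
    ultimately show "openin X {x \<in> topspace X. q x \<in> \<Union>K}"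
      by (simp only:)
  qed auto
  then show ?thesis
    unfolding quotient_topology_def by (simp only: topology_inverse')
qed

lemma topspace_quotient_topology [simp]:
  "topspace (quotient_topology X q) = q ` topspace X"
proof (rule subset_antisym)
  show "topspace (quotient_topology X q) \<subseteq> q ` topspace X"
    using openin_topspace[of "quotient_topology X q"]
    by (simp only: openin_quotient_topology)
  have "{x \<in> topspace X. q x \<in> q ` topspace X} = topspace X"
    by auto
  then have "openin (quotient_topology X q) (q ` topspace X)"
    by (simp add: openin_quotient_topology)
  then show "q ` topspace X \<subseteq> topspace (quotient_topology X q)"
    by (rule openin_subset)
qed

lemma quotient_map_quotient_topology: "quotient_map X (quotient_topology X q) q"
  by (simp add: quotient_map_def openin_quotient_topology)

text \<open>A point of projective space is a line with the origin removed.\<close>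

definition proj_class :: "'a::field ^ 'n \<Rightarrow> ('a ^ 'n) set" where
  "proj_class v = {k *s v | k. k \<noteq> 0}"

definition projective_space :: "('a::{field,topological_space} ^ 'n) set topology" where
  "projective_space = quotient_topology (top_of_set (UNIV - {0})) proj_class"

abbreviation RP3 :: "(real ^ 4) set topology" where
  "RP3 \<equiv> projective_space"

abbreviation CP1 :: "(complex ^ 2) set topology" where
  "CP1 \<equiv> projective_space"

text \<open>\<open>SP3 X\<close> is \<open>X\<^sup>3 / S\<^sub>3\<close>: an orbit of \<open>S\<^sub>3\<close> on triples is recorded as a multiset
  of size three.\<close>

definition SP3 :: "'a topology \<Rightarrow> 'a multiset topology" where
  "SP3 X = quotient_topology (prod_topology X (prod_topology X X)) (\<lambda>(p, q, r). {#p, q, r#})"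


section \<open>PSL(2,R) and its actions\<close>

definition SL2 :: "(real ^ 2 ^ 2) monoid" where
  "SL2 = \<lparr>carrier = {A. det A = 1}, mult = (**), one = mat 1\<rparr>"

definition PSL2 :: "(real ^ 2 ^ 2) set monoid" where
  "PSL2 = SL2 Mod {mat 1, - mat 1}"

definition psl_class :: "real ^ 2 ^ 2 \<Rightarrow> (real ^ 2 ^ 2) set" where
  "psl_class A = {mat 1, - mat 1} #>\<^bsub>SL2\<^esub> A"

text \<open>\<open>psl_act X act\<close> passes from a formula \<open>act\<close> for matrices to the quotient group. It is
  meaningful only if \<open>act\<close> does not depend on the representative; this independence
  is the first clause of \<open>admits_psl_action\<close>.\<close>

definition psl_act ::
    "'a topology \<Rightarrow> (real ^ 2 ^ 2 \<Rightarrow> 'a \<Rightarrow> 'a) \<Rightarrow> (real ^ 2 ^ 2) set \<Rightarrow> 'a \<Rightarrow> 'a" where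
  "psl_act X act g = (\<lambda>x \<in> topspace X. the_elem ((\<lambda>A. act A x) ` g))"

definition admits_psl_action :: "'a topology \<Rightarrow> (real ^ 2 ^ 2 \<Rightarrow> 'a \<Rightarrow> 'a) \<Rightarrow> bool" where
  "admits_psl_action X act \<longleftrightarrow>
     (\<forall>A \<in> carrier SL2. \<forall>x \<in> topspace X. psl_act X act (psl_class A) x = act A x) \<and>
     group_action PSL2 (topspace X) (psl_act X act) \<and>
     (\<forall>g \<in> carrier PSL2. homeomorphic_map X X (psl_act X act g))"

definition psl_isomorphic ::
    "'a topology \<Rightarrow> (real ^ 2 ^ 2 \<Rightarrow> 'a \<Rightarrow> 'a) \<Rightarrow>
     'b topology \<Rightarrow> (real ^ 2 ^ 2 \<Rightarrow> 'b \<Rightarrow> 'b) \<Rightarrow> bool" where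
  "psl_isomorphic X actX Y actY \<longleftrightarrow>
     (\<exists>h. homeomorphic_map X Y h \<and>
       (\<forall>g \<in> carrier PSL2. \<forall>x \<in> topspace X.
          h (psl_act X actX g x) = psl_act Y actY g (h x)))"


section \<open>Real binary cubics with negative discriminant\<close>

text \<open>The point \<open>(a, b, c, d)\<close> of \<open>real ^ 4\<close> stands for the cubic
  \<open>a x\<^sup>3 + b x\<^sup>2 y + c x y\<^sup>2 + d y\<^sup>3\<close>.\<close>

definition cubic_form :: "real ^ 4 \<Rightarrow> real ^ 2 \<Rightarrow> real" where
  "cubic_form f u =
     f $ 1 * (u $ 1) ^ 3 + f $ 2 * (u $ 1) ^ 2 * u $ 2
     + f $ 3 * u $ 1 * (u $ 2) ^ 2 + f $ 4 * (u $ 2) ^ 3"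

definition disc3 :: "real \<Rightarrow> real \<Rightarrow> real \<Rightarrow> real \<Rightarrow> real" where
  "disc3 a b c d =
     b^2 * c^2 - 4 * a * c^3 - 4 * b^3 * d - 27 * a^2 * d^2 + 18 * a * b * c * d"

definition Delta_minus :: "(real ^ 4) set set" where
  "Delta_minus = {proj_class f | f. disc3 (f $ 1) (f $ 2) (f $ 3) (f $ 4) < 0}"

definition Delta_minus_top :: "(real ^ 4) set topology" where
  "Delta_minus_top = subtopology RP3 Delta_minus"

text \<open>\<open>[f] \<mapsto> [f \<circ> A\<^sup>-\<^sup>1]\<close>, carried out on all representatives of the class. A form
  determines its coefficients, so the result is again a single projective class.\<close>

definition cubic_act :: "real ^ 2 ^ 2 \<Rightarrow> (real ^ 4) set \<Rightarrow> (real ^ 4) set" where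
  "cubic_act A P =
     {g. \<exists>f \<in> P. cubic_form g = cubic_form f \<circ> (\<lambda>u. matrix_inv A *v u)}"


section \<open>Root sets\<close>

definition RP1_in_CP1 :: "(complex ^ 2) set set" where
  "RP1_in_CP1 = {proj_class (vector [of_real x, of_real y]) | x y :: real. (x, y) \<noteq> (0, 0)}"

definition cp1_of :: "complex \<Rightarrow> (complex ^ 2) set" where
  "cp1_of z = proj_class (vector [z, 1])"

definition root_sets :: "(complex ^ 2) set multiset set" where
  "root_sets = {{#r, cp1_of z, cp1_of (cnj z)#} | r z. r \<in> RP1_in_CP1 \<and> z \<notin> \<real>}"

definition root_sets_top :: "(complex ^ 2) set multiset topology" where
  "root_sets_top = subtopology (SP3 CP1) root_sets"

text \<open>The Moebius transformation \<open>[x : y] \<mapsto> [a x + b y : c x + d y]\<close> of the complex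
  projective line.\<close>

definition cp1_moebius :: "real ^ 2 ^ 2 \<Rightarrow> (complex ^ 2) set \<Rightarrow> (complex ^ 2) set" where
  "cp1_moebius A L = (\<lambda>u. map_matrix complex_of_real A *v u) ` L"

definition root_act ::
    "real ^ 2 ^ 2 \<Rightarrow> (complex ^ 2) set multiset \<Rightarrow> (complex ^ 2) set multiset" where
  "root_act A M = image_mset (cp1_moebius A) M"


section \<open>The unit tangent bundle of the hyperbolic plane\<close>

definition upper_half_plane :: "complex set" where
  "upper_half_plane = {p. Im p > 0}"

text \<open>The metric \<open>(dx\<^sup>2 + dy\<^sup>2) / y\<^sup>2\<close>; all tangent spaces are identified with the complex
  plane, which contains the half plane as an open subset.\<close>

definition hyp_metric :: "complex \<Rightarrow> complex \<Rightarrow> complex \<Rightarrow> real" where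
  "hyp_metric p v w = (v \<bullet> w) / (Im p)\<^sup>2"

definition hyp_norm :: "complex \<Rightarrow> complex \<Rightarrow> real" where
  "hyp_norm p v = sqrt (hyp_metric p v v)"

definition UTH :: "(complex \<times> complex) set" where
  "UTH = {(p, v). p \<in> upper_half_plane \<and> hyp_norm p v = 1}"

definition UTH_top :: "(complex \<times> complex) topology" where
  "UTH_top = top_of_set UTH"

definition moebius :: "real ^ 2 ^ 2 \<Rightarrow> complex \<Rightarrow> complex" where
  "moebius A z =
     (of_real (A $ 1 $ 1) * z + of_real (A $ 1 $ 2)) /
     (of_real (A $ 2 $ 1) * z + of_real (A $ 2 $ 2))"

definition UTH_act :: "real ^ 2 ^ 2 \<Rightarrow> complex \<times> complex \<Rightarrow> complex \<times> complex" where
  "UTH_act A = (\<lambda>(p, v). (moebius A p, frechet_derivative (moebius A) (at p) v))"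

end

(*
  A frame is a pair (p, w) with p in the upper half plane and w a nonzero complex number; SL(2,R)
  acts by A(p, w) = (Ap, w(cp + d)). Such a pair gives the real cubic |x - p y|^2 Re(w(x - p y)),
  whose roots are p, its conjugate and the real point [Re(wp) : Re w], and it gives the unit
  tangent vector Im p * conj(w)/w at p. As the linear form x - p y is multiplied by cp + d under
  the substitution by the inverse of A, and tangent vectors by (cp + d)^(-2), all three
  assignments are equivariant. Each of them is a quotient map whose fibres are the real lines
  in w, so the three quotients are canonically homeomorphic. For cubics, openness of the map
  comes from invariance of domain in R^4, which replaces continuity of the roots.
*)

theory Submission
  imports Defs
begin

section \<open>The groups \<open>SL(2, \<real>)\<close> and \<open>PSL(2, \<real>)\<close>\<close>

text \<open>A direct homeomorphism would need the roots of a cubic, or a square root of a unit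
  complex number, as continuous functions. The second does not exist globally: cnj w / w = v / Im p
  fixes w up to a real factor, and along a full turn of v a continuous w returns multiplied by a
  negative number. Frames reverse the direction of the maps: each target is given by explicit
  formulas in (p, w), and only fibres have to be compared. The same ambiguity explains the groups:
  -1 in SL(2,R) acts on frames by w -> -w, and this sign is lost in each of the quotients. For root
  sets the obstacle is that the roots are unordered. It disappears because they lie in the disjoint
  sets Im z > 0, RP^1 and Im z < 0.\<close>

lemma SL2_simps [simp]:
  "carrier SL2 = {A. det A = 1}" "A \<otimes>\<^bsub>SL2\<^esub> B = A ** B" "\<one>\<^bsub>SL2\<^esub> = mat 1"
  by (simp_all add: SL2_def)

lemma matrix_eq_2: "(A :: 'a ^ 2 ^ 2) = B \<longleftrightarrow>
    A $ 1 $ 1 = B $ 1 $ 1 \<and> A $ 1 $ 2 = B $ 1 $ 2 \<and> A $ 2 $ 1 = B $ 2 $ 1 \<and> A $ 2 $ 2 = B $ 2 $ 2"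
  by (auto simp: vec_eq_iff forall_2)

lemma matrix_mult_2: "((A :: 'a::semiring_1 ^ 2 ^ 2) ** B) $ i $ j = A $ i $ 1 * B $ 1 $ j + A $ i $ 2 * B $ 2 $ j"
  by (simp add: matrix_matrix_mult_def sum_2)

lemma matrix_vector_mult_2: "((A :: 'a::semiring_1 ^ 2 ^ 2) *v u) $ i = A $ i $ 1 * u $ 1 + A $ i $ 2 * u $ 2"
  by (simp add: matrix_vector_mult_def sum_2)

lemma matrix_mul_minus_left: "(- A) ** B = - (A ** B)" for A B :: "real ^ 2 ^ 2"
  by (simp add: matrix_eq_2 matrix_mult_2)

lemma matrix_mul_minus_right: "A ** (- B) = - (A ** B)" for A B :: "real ^ 2 ^ 2"
  by (simp add: matrix_eq_2 matrix_mult_2)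

lemma det_uminus_2: "det (- A) = det A" for A :: "real ^ 2 ^ 2"
  by (simp add: det_2)

lemma SL2_inverse:
  fixes A :: "real ^ 2 ^ 2"
  assumes "det A = 1"
  obtains B where "det B = 1" "A ** B = mat 1" "B ** A = mat 1"
proof
  \<comment> \<open>The adjugate, which inverts A because the determinant is 1.\<close>
  define B :: "real ^ 2 ^ 2" where
    "B = vector [vector [A $ 2 $ 2, - (A $ 1 $ 2)], vector [- (A $ 2 $ 1), A $ 1 $ 1]]"
  show "det B = 1" "A ** B = mat 1" "B ** A = mat 1"
    using assms by (simp_all add: B_def det_2 matrix_eq_2 matrix_mult_2 mat_def algebra_simps)
qed

lemma group_SL2: "group SL2"
proof (rule groupI)
  fix A assume "A \<in> carrier SL2"
  then show "\<exists>B\<in>carrier SL2. B \<otimes>\<^bsub>SL2\<^esub> A = \<one>\<^bsub>SL2\<^esub>"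
    using SL2_inverse[of A] by auto
qed (auto simp: det_mul matrix_mul_assoc)

lemma psl_class_eq: "psl_class A = {A, - A}"
  by (auto simp: psl_class_def r_coset_def matrix_mul_minus_left)

lemma normal_center_SL2: "{mat 1, - mat 1} \<lhd> SL2"
proof -
  interpret group SL2 by (rule group_SL2)
  have inv_minus: "inv\<^bsub>SL2\<^esub> (- mat 1) = - mat 1"
    by (rule inv_equality) (auto simp: matrix_mul_minus_left det_uminus_2)
  have inv_one: "inv\<^bsub>SL2\<^esub> (mat 1) = mat 1"
    by (rule inv_equality) auto
  have "subgroup {mat 1, - mat 1} SL2"
    by (rule subgroupI) (auto simp: det_uminus_2 inv_minus inv_one matrix_mul_minus_left)
  then show ?thesis
    by (auto simp: normal_def normal_axioms_def r_coset_def l_coset_def group_SL2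
      matrix_mul_minus_left matrix_mul_minus_right)
qed

lemma group_PSL2: "group PSL2"
  unfolding PSL2_def by (rule normal.factorgroup_is_group[OF normal_center_SL2])

lemma carrier_PSL2: "carrier PSL2 = psl_class ` {A. det A = 1}"
  by (auto simp: PSL2_def FactGroup_def RCOSETS_def psl_class_def)

lemma mult_PSL2: "psl_class A \<otimes>\<^bsub>PSL2\<^esub> psl_class B = psl_class (A ** B)"
  by (auto simp: PSL2_def FactGroup_def set_mult_def psl_class_eq
      matrix_mul_minus_left matrix_mul_minus_right)


section \<open>Spaces presented as equivariant quotients\<close>

text \<open>On \<open>P\<close> only the matrices have to act, and -1 may act nontrivially;
  \<open>q_uminus\<close> demands that the sign be lost after applying \<open>q\<close>. Everything
  required of an action of PSL(2,R) on \<open>X\<close> then descends along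
  \<open>q\<close>.\<close>

locale psl_presentation =
  fixes P :: "'p topology" and actP :: "real ^ 2 ^ 2 \<Rightarrow> 'p \<Rightarrow> 'p"
    and X :: "'x topology" and act :: "real ^ 2 ^ 2 \<Rightarrow> 'x \<Rightarrow> 'x" and q :: "'p \<Rightarrow> 'x"
  assumes quotient: "quotient_map P X q"
    and continuous_actP: "det A = 1 \<Longrightarrow> continuous_map P P (actP A)"
    and actP_one: "x \<in> topspace P \<Longrightarrow> actP (mat 1) x = x"
    and actP_mult: "det A = 1 \<Longrightarrow> det B = 1 \<Longrightarrow> x \<in> topspace P \<Longrightarrow>
          actP (A ** B) x = actP A (actP B x)"
    and equivariant: "det A = 1 \<Longrightarrow> x \<in> topspace P \<Longrightarrow> act A (q x) = q (actP A x)"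
    and q_uminus: "det A = 1 \<Longrightarrow> x \<in> topspace P \<Longrightarrow> q (actP (- A) x) = q (actP A x)"
begin

lemma topspace_X: "topspace X = q ` topspace P"
  using quotient by (simp add: quotient_imp_surjective_map)

lemma actP_closed: "det A = 1 \<Longrightarrow> x \<in> topspace P \<Longrightarrow> actP A x \<in> topspace P"
  using continuous_map_image_subset_topspace[OF continuous_actP] by blast

text \<open>Both representatives A and -A give the same value, so the image that
  \<open>the_elem\<close> inspects is a singleton.\<close>

lemma psl_act_q:
  assumes "det A = 1" "x \<in> topspace P"
  shows "psl_act X act (psl_class A) (q x) = q (actP A x)"
proof -
  have "(\<lambda>B. act B (q x)) ` psl_class A = {q (actP A x)}"
    using assms by (auto simp: psl_class_eq equivariant q_uminus det_uminus_2)
  then show ?thesis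
    using assms by (simp add: psl_act_def topspace_X)
qed

lemma continuous_psl_act:
  assumes "det A = 1"
  shows "continuous_map X X (psl_act X act (psl_class A))"
proof (rule continuous_compose_quotient_map[OF quotient])
  have "continuous_map P X (q \<circ> actP A)"
    using continuous_actP[OF assms] quotient_imp_continuous_map[OF quotient]
    by (rule continuous_map_compose)
  then show "continuous_map P X (psl_act X act (psl_class A) \<circ> q)"
    by (rule continuous_map_eq) (simp add: psl_act_q assms)
qed

lemma psl_act_one: "y \<in> topspace X \<Longrightarrow> psl_act X act (psl_class (mat 1)) y = y"
  by (auto simp: topspace_X psl_act_q actP_one)

lemma psl_act_mult:
  "det A = 1 \<Longrightarrow> det B = 1 \<Longrightarrow> y \<in> topspace X \<Longrightarrow>
    psl_act X act (psl_class (A ** B)) y =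
    psl_act X act (psl_class A) (psl_act X act (psl_class B) y)"
  by (auto simp: topspace_X psl_act_q actP_mult actP_closed det_mul)

lemma homeomorphic_psl_act:
  assumes "det A = 1"
  shows "homeomorphic_map X X (psl_act X act (psl_class A))"
proof -
  obtain B where B: "det B = 1" "A ** B = mat 1" "B ** A = mat 1"
    using SL2_inverse[OF assms] .
  have "homeomorphic_maps X X (psl_act X act (psl_class A)) (psl_act X act (psl_class B))"
    using assms B
    by (auto simp: homeomorphic_maps_def continuous_psl_act psl_act_one simp flip: psl_act_mult)
  then show ?thesis
    by (rule homeomorphic_maps_imp_map)
qed

lemma psl_act_Bij:
  assumes "det A = 1"
  shows "psl_act X act (psl_class A) \<in> Bij (topspace X)"
  using homeomorphic_psl_act[OF assms, THEN homeomorphic_imp_injective_map]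
    homeomorphic_psl_act[OF assms, THEN homeomorphic_imp_surjective_map]
  by (simp add: Bij_def bij_betw_def psl_act_def)

lemma psl_act_group_action: "group_action PSL2 (topspace X) (psl_act X act)"
proof -
  have "psl_act X act \<in> hom PSL2 (BijGroup (topspace X))"
  proof (rule homI)
    fix g assume "g \<in> carrier PSL2"
    then show "psl_act X act g \<in> carrier (BijGroup (topspace X))"
      by (auto simp: carrier_PSL2 BijGroup_def psl_act_Bij)
  next
    fix g h assume "g \<in> carrier PSL2" "h \<in> carrier PSL2"
    then obtain A B where A: "det A = 1" "g = psl_class A" and B: "det B = 1" "h = psl_class B"
      by (auto simp: carrier_PSL2)
    \<comment> \<open>Permutations in \<open>BijGroup\<close> are extensional functions, so the
      equation is also checked off the space, where both sides are \<open>undefined\<close>.\<close>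
    have "psl_act X act (psl_class (A ** B)) =
        compose (topspace X) (psl_act X act (psl_class A)) (psl_act X act (psl_class B))"
    proof
      fix y
      show "psl_act X act (psl_class (A ** B)) y =
          compose (topspace X) (psl_act X act (psl_class A)) (psl_act X act (psl_class B)) y"
        by (cases "y \<in> topspace X") (auto simp: compose_def psl_act_mult A B, simp add: psl_act_def)
    qed
    then show "psl_act X act (g \<otimes>\<^bsub>PSL2\<^esub> h) =
        psl_act X act g \<otimes>\<^bsub>BijGroup (topspace X)\<^esub> psl_act X act h"
      by (simp add: A B mult_PSL2 BijGroup_def psl_act_Bij)
  qed
  then show ?thesis
    by (simp add: group_action_def group_hom_def group_hom_axioms_def group_PSL2 group_BijGroup)
qed

lemma admits: "admits_psl_action X act"
  unfolding admits_psl_action_def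
proof (intro conjI ballI)
  fix A x assume "A \<in> carrier SL2" "x \<in> topspace X"
  then show "psl_act X act (psl_class A) x = act A x"
    by (auto simp: topspace_X psl_act_q equivariant)
next
  fix g assume "g \<in> carrier PSL2"
  then show "homeomorphic_map X X (psl_act X act g)"
    by (auto simp: carrier_PSL2 homeomorphic_psl_act)
qed (rule psl_act_group_action)

end

text \<open>Equal fibres let \<open>g\<close> factor through \<open>f\<close> by a map h. Since h
  composed with \<open>f\<close> is a quotient map, so is h, and an injective quotient map is a
  homeomorphism. No inverse has to be written down.\<close>

lemma psl_isomorphic_presentations:
  assumes X: "psl_presentation P actP X actX f" and Y: "psl_presentation P actP Y actY g"
    and fibres: "\<And>x y. x \<in> topspace P \<Longrightarrow> y \<in> topspace P \<Longrightarrow> f x = f y \<longleftrightarrow> g x = g y"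
  shows "psl_isomorphic X actX Y actY"
proof -
  interpret X: psl_presentation P actP X actX f by (rule X)
  interpret Y: psl_presentation P actP Y actY g by (rule Y)
  obtain h where h: "\<And>x. x \<in> topspace P \<Longrightarrow> h (f x) = g x"
    using quotient_map_lift_exists[OF X.quotient quotient_imp_continuous_map[OF Y.quotient]] fibres
    by metis
  have "quotient_map P Y (h \<circ> f)"
    by (rule quotient_map_eq[OF Y.quotient]) (simp add: h)
  then have "quotient_map X Y h"
    by (simp add: quotient_map_compose_eq[OF X.quotient])
  moreover have "inj_on h (topspace X)"
    by (auto simp: inj_on_def X.topspace_X h fibres)
  ultimately have "homeomorphic_map X Y h"
    by (simp add: homeomorphic_map_def)
  moreover have "h (psl_act X actX k x) = psl_act Y actY k (h x)"
    if "k \<in> carrier PSL2" "x \<in> topspace X" for k x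
    using that
    by (auto simp: carrier_PSL2 X.topspace_X X.psl_act_q Y.psl_act_q h X.actP_closed)
  ultimately show ?thesis
    unfolding psl_isomorphic_def by blast
qed

section \<open>Frames\<close>

text \<open>One real dimension more than the spaces to be compared: a frame stands for a cubic
  itself and not for its scaling class.\<close>

definition frames :: "(complex \<times> complex) set" where
  "frames = {(p, w). Im p > 0 \<and> w \<noteq> 0}"

definition automorphy :: "real ^ 2 ^ 2 \<Rightarrow> complex \<Rightarrow> complex" where
  "automorphy A p = of_real (A $ 2 $ 1) * p + of_real (A $ 2 $ 2)"

definition frame_act :: "real ^ 2 ^ 2 \<Rightarrow> complex \<times> complex \<Rightarrow> complex \<times> complex" where
  "frame_act A = (\<lambda>(p, w). (moebius A p, w * automorphy A p))"

lemma open_frames: "open frames"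
proof -
  have eq: "frames = {p. Im p > 0} \<times> (- {0})"
    by (auto simp: frames_def)
  show ?thesis
    unfolding eq by (intro open_Times open_halfspace_Im_gt open_Compl closed_singleton)
qed

text \<open>A zero at a nonreal point would force c = 0 and then d = 0.\<close>

lemma automorphy_nonzero:
  assumes "det A = 1" "Im p > 0"
  shows "automorphy A p \<noteq> 0"
proof
  assume "automorphy A p = 0"
  then have "A $ 2 $ 1 * Re p + A $ 2 $ 2 = 0" "A $ 2 $ 1 * Im p = 0"
    by (simp_all add: automorphy_def complex_eq_iff)
  with assms show False
    by (auto simp: det_2)
qed

text \<open>Clears the denominator, so that later identities become polynomial.\<close>

lemma moebius_times_automorphy:
  assumes "det A = 1" "Im p > 0"
  shows "moebius A p * automorphy A p = of_real (A $ 1 $ 1) * p + of_real (A $ 1 $ 2)"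
  using automorphy_nonzero[OF assms] by (simp add: moebius_def automorphy_def)

lemma Im_moebius:
  assumes "det A = 1" "Im p > 0"
  shows "Im (moebius A p) = Im p / (cmod (automorphy A p))\<^sup>2"
proof -
  have "(A $ 1 $ 1 * Im p) * (A $ 2 $ 1 * Re p + A $ 2 $ 2) -
      (A $ 1 $ 1 * Re p + A $ 1 $ 2) * (A $ 2 $ 1 * Im p) = Im p * det A"
    by (simp add: det_2 algebra_simps)
  then show ?thesis
    using assms by (simp add: moebius_def automorphy_def Im_divide cmod_power2)
qed

lemma Im_moebius_pos:
  assumes "det A = 1" "Im p > 0"
  shows "Im (moebius A p) > 0"
  using automorphy_nonzero[OF assms] assms by (simp add: Im_moebius)

text \<open>The cocycle relation; it makes \<open>frame_act\<close> multiplicative in the second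
  entry.\<close>

lemma automorphy_mult:
  assumes "det B = 1" "Im p > 0"
  shows "automorphy (A ** B) p = automorphy A (moebius B p) * automorphy B p"
proof -
  have "automorphy A (moebius B p) * automorphy B p =
      of_real (A $ 2 $ 1) * (moebius B p * automorphy B p) + of_real (A $ 2 $ 2) * automorphy B p"
    by (simp add: automorphy_def algebra_simps)
  also have "\<dots> = automorphy (A ** B) p"
    unfolding moebius_times_automorphy[OF assms]
    by (simp add: automorphy_def matrix_mult_2 algebra_simps)
  finally show ?thesis ..
qed

text \<open>Multiplication by \<open>automorphy (A ** B) p\<close>, which splits by the cocycle
  relation, removes both nested denominators.\<close>

lemma moebius_mult:
  assumes "det A = 1" "det B = 1" "Im p > 0"
  shows "moebius (A ** B) p = moebius A (moebius B p)"
proof -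
  have AB: "det (A ** B) = 1"
    by (simp add: det_mul assms)
  have "moebius A (moebius B p) * automorphy (A ** B) p =
      (moebius A (moebius B p) * automorphy A (moebius B p)) * automorphy B p"
    by (simp add: automorphy_mult assms)
  also have "\<dots> = of_real (A $ 1 $ 1) * (moebius B p * automorphy B p) + of_real (A $ 1 $ 2) * automorphy B p"
    unfolding moebius_times_automorphy[OF assms(1) Im_moebius_pos[OF assms(2,3)]]
    by (simp add: algebra_simps)
  also have "\<dots> = of_real ((A ** B) $ 1 $ 1) * p + of_real ((A ** B) $ 1 $ 2)"
    unfolding moebius_times_automorphy[OF assms(2,3)]
    by (simp add: automorphy_def matrix_mult_2 algebra_simps)
  also have "\<dots> = moebius (A ** B) p * automorphy (A ** B) p"
    by (simp add: moebius_times_automorphy[OF AB assms(3)])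
  finally show ?thesis
    using automorphy_nonzero[OF AB assms(3)] by simp
qed

lemma moebius_uminus: "moebius (- A) p = moebius A p"
proof -
  have "moebius (- A) p = (- (of_real (A $ 1 $ 1) * p + of_real (A $ 1 $ 2))) /
      (- (of_real (A $ 2 $ 1) * p + of_real (A $ 2 $ 2)))"
    by (simp add: moebius_def)
  then show ?thesis
    by (simp only: minus_divide_divide moebius_def)
qed

lemma frame_act_uminus: "frame_act (- A) (p, w) = (moebius A p, - (w * automorphy A p))"
  by (simp add: frame_act_def moebius_uminus automorphy_def algebra_simps)

lemma frame_act_in_frames: "det A = 1 \<Longrightarrow> x \<in> frames \<Longrightarrow> frame_act A x \<in> frames"
  by (auto simp: frames_def frame_act_def Im_moebius_pos automorphy_nonzero)

lemma continuous_frame_act: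
  assumes "det A = 1"
  shows "continuous_map (top_of_set frames) (top_of_set frames) (frame_act A)"
proof -
  have nz: "of_real (A $ 2 $ 1) * fst x + of_real (A $ 2 $ 2) \<noteq> (0::complex)" if "x \<in> frames" for x
    using automorphy_nonzero[OF assms, of "fst x"] that by (auto simp: automorphy_def frames_def)
  show ?thesis
    using frame_act_in_frames[OF assms] nz
    unfolding frame_act_def moebius_def automorphy_def case_prod_unfold
    by (auto intro!: continuous_intros)
qed

lemma frame_act_one: "frame_act (mat 1) x = x"
  by (simp add: frame_act_def moebius_def automorphy_def mat_def split: prod.split)

lemma frame_act_mult:
  assumes "det A = 1" "det B = 1" "x \<in> frames"
  shows "frame_act (A ** B) x = frame_act A (frame_act B x)"
  using assms by (auto simp: frames_def frame_act_def moebius_mult automorphy_mult)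

text \<open>The matrix -A moves p as A does and negates the second entry, so \<open>q_uminus\<close>
  comes down to invariance of \<open>q\<close> under w -> -w.\<close>

lemma psl_presentation_frames:
  assumes "quotient_map (top_of_set frames) X q"
    and "\<And>A x. det A = 1 \<Longrightarrow> x \<in> frames \<Longrightarrow> act A (q x) = q (frame_act A x)"
    and "\<And>p w. (p, w) \<in> frames \<Longrightarrow> q (p, - w) = q (p, w)"
  shows "psl_presentation (top_of_set frames) frame_act X act q"
proof
  fix A :: "real ^ 2 ^ 2" and x assume A: "det A = 1" "x \<in> topspace (top_of_set frames)"
  obtain p w where x: "x = (p, w)"
    by fastforce
  have "frame_act A (p, w) \<in> frames"
    using A by (simp add: frame_act_in_frames x)
  then show "q (frame_act (- A) x) = q (frame_act A x)"
    using assms(3) by (simp add: x frame_act_uminus) (simp add: frame_act_def)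
qed (use assms in \<open>auto simp: continuous_frame_act frame_act_one frame_act_mult
    simp del: continuous_map_subtopology_eu\<close>)


section \<open>The unit tangent bundle\<close>

text \<open>For p = i and w = 1 the vector is 1 and the real root is 0. By equivariance the vector
  is in general the direction of the geodesic from p to the real root, turned counterclockwise by a
  right angle.\<close>

definition frame_vector :: "complex \<times> complex \<Rightarrow> complex \<times> complex" where
  "frame_vector = (\<lambda>(p, w). (p, of_real (Im p) * cnj w / w))"

lemma UTH_iff: "(p, v) \<in> UTH \<longleftrightarrow> Im p > 0 \<and> cmod v = Im p"
proof (cases "Im p > 0")
  case True
  then have "hyp_norm p v = cmod v / Im p"
    by (simp add: hyp_norm_def hyp_metric_def real_sqrt_divide norm_eq_sqrt_inner)
  with True show ?thesis
    by (auto simp: UTH_def upper_half_plane_def)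
qed (auto simp: UTH_def upper_half_plane_def)

text \<open>If the preimage of V under \<open>q\<close> is open, pulling it back along a section
  over U shows that the intersection of U and V is open. Hence V is a neighbourhood of each of its
  points.\<close>

lemma quotient_map_local_sections:
  assumes q: "continuous_map X Y q"
    and sections: "\<And>y. y \<in> topspace Y \<Longrightarrow> \<exists>U s. openin Y U \<and> y \<in> U \<and>
      continuous_map (subtopology Y U) X s \<and> (\<forall>z\<in>U. q (s z) = z)"
  shows "quotient_map X Y q"
  unfolding quotient_map_def
proof (intro conjI allI impI)
  show "q ` topspace X = topspace Y"
  proof
    show "q ` topspace X \<subseteq> topspace Y"
      using q by (rule continuous_map_image_subset_topspace)
    show "topspace Y \<subseteq> q ` topspace X"
    proof
      fix y assume y: "y \<in> topspace Y"
      then obtain U s where s: "y \<in> U" "continuous_map (subtopology Y U) X s" "q (s y) = y"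
        using sections by blast
      then have "s y \<in> topspace X"
        using continuous_map_image_subset_topspace[OF s(2)] y by auto
      with s(3) show "y \<in> q ` topspace X"
        by force
    qed
  qed
next
  fix V assume V: "V \<subseteq> topspace Y"
  show "openin X {x \<in> topspace X. q x \<in> V} = openin Y V"
  proof
    assume "openin Y V"
    then show "openin X {x \<in> topspace X. q x \<in> V}"
      by (rule openin_continuous_map_preimage[OF q])
  next
    assume preim: "openin X {x \<in> topspace X. q x \<in> V}"
    show "openin Y V"
    proof (subst openin_subopen, intro ballI)
      fix y assume y: "y \<in> V"
      with V obtain U s where U: "openin Y U" "y \<in> U" and s: "continuous_map (subtopology Y U) X s"
        and qs: "\<And>z. z \<in> U \<Longrightarrow> q (s z) = z"
        using sections by (metis subsetD)
      have "openin (subtopology Y U)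
          {z \<in> topspace (subtopology Y U). s z \<in> {x \<in> topspace X. q x \<in> V}}"
        by (rule openin_continuous_map_preimage[OF s preim])
      moreover have "{z \<in> topspace (subtopology Y U). s z \<in> {x \<in> topspace X. q x \<in> V}} = U \<inter> V"
        using continuous_map_image_subset_topspace[OF s] openin_subset[OF U(1)]
        by (auto simp: qs)
      ultimately have "openin Y (U \<inter> V)"
        using U(1) openin_trans_full by metis
      with U y show "\<exists>T. openin Y T \<and> y \<in> T \<and> T \<subseteq> V"
        by blast
    qed
  qed
qed

lemma quotient_map_frame_vector: "quotient_map (top_of_set frames) UTH_top frame_vector"
  unfolding UTH_top_def
proof (rule quotient_map_local_sections)
  have "frame_vector x \<in> UTH" if "x \<in> frames" for x
    using that by (auto simp: frames_def frame_vector_def UTH_iff norm_divide norm_mult)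
  moreover have "continuous_on frames frame_vector"
    unfolding frame_vector_def case_prod_unfold
    by (auto simp: frames_def intro!: continuous_intros)
  ultimately show "continuous_map (top_of_set frames) (top_of_set UTH) frame_vector"
    by auto
next
  fix y assume "y \<in> topspace (top_of_set UTH)"
  then obtain p v where y: "y = (p, v)" and p: "Im p > 0" and v: "cmod v = Im p"
    by (cases y) (auto simp: UTH_iff)
  define U where "U c = {x \<in> UTH. snd x \<noteq> c * of_real (Im (fst x))}" for c :: complex
  have ope: "openin (top_of_set UTH) (U c)" for c
  proof -
    have "open {x :: complex \<times> complex. snd x \<noteq> c * of_real (Im (fst x))}"
      by (intro open_Collect_neq continuous_intros)
    moreover have "U c = UTH \<inter> {x. snd x \<noteq> c * of_real (Im (fst x))}"
      by (auto simp: U_def)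
    ultimately show ?thesis
      by (auto simp: openin_open)
  qed
  \<comment> \<open>A section needs a continuous choice of \<open>w\<close> with \<open>cnj w / w = v / Im p\<close>. The choice
    below vanishes at \<open>v = c Im p\<close> only, and two values of \<open>c\<close> cover the fibre.\<close>
  have sections: "\<exists>s. continuous_map (subtopology (top_of_set UTH) (U c)) (top_of_set frames) s \<and>
      (\<forall>z\<in>U c. frame_vector (s z) = z)"
    if c: "cmod c = 1" and k: "k \<noteq> 0" "cnj k = - c * k" for c k
  proof (intro exI conjI ballI)
    \<comment> \<open>With u = v / Im p, a complex number of modulus 1, this sets w = k Im p (1 - c
      cnj u). The condition on k makes both cnj w and u w equal to k Im p (u - c). It holds for c =
      1, k = i and for c = -1, k = 1.\<close>
    let ?s = "\<lambda>x. (fst x, k * (of_real (Im (fst x)) - c * cnj (snd x)))"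
    have cc: "c * cnj c = 1"
      using c by (simp add: complex_norm_square[symmetric])
    have nz: "of_real (Im p) - c * cnj v \<noteq> 0" if "v \<noteq> c * of_real (Im p)" for p v
    proof
      assume "of_real (Im p) - c * cnj v = 0"
      then have "cnj (of_real (Im p) - c * cnj v) = 0"
        by simp
      then have "of_real (Im p) = cnj c * v"
        by simp
      then have "c * of_real (Im p) = (c * cnj c) * v"
        by simp
      with cc that show False
        by simp
    qed
    have "?s x \<in> frames" if "x \<in> U c" for x
      using that nz[of "snd x" "fst x"] k by (cases x) (auto simp: U_def frames_def UTH_iff)
    moreover have "continuous_on (U c) ?s"
      by (intro continuous_intros)
    moreover have "subtopology (top_of_set UTH) (U c) = top_of_set (U c)"
      by (simp add: subtopology_subtopology U_def Int_absorb1)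
    ultimately show "continuous_map (subtopology (top_of_set UTH) (U c)) (top_of_set frames) ?s"
      by auto
    fix z assume z: "z \<in> U c"
    then obtain p v where pv: "z = (p, v)" "Im p > 0" "cmod v = Im p" "v \<noteq> c * of_real (Im p)"
      by (cases z) (auto simp: U_def UTH_iff)
    let ?w = "k * (of_real (Im p) - c * cnj v)"
    have vv: "v * cnj v = of_real (Im p) * of_real (Im p)"
      using complex_norm_square[of v] pv by (simp add: power2_eq_square)
    have "of_real (Im p) * cnj ?w =
        k * ((c * cnj c) * of_real (Im p) * v - c * (of_real (Im p) * of_real (Im p)))"
      using k by (simp add: algebra_simps)
    also have "\<dots> = v * ?w"
      by (simp add: cc vv[symmetric] algebra_simps)
    finally show "frame_vector (?s z) = z"
      using nz[OF pv(4)] k by (simp add: frame_vector_def pv field_simps)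
  qed
  have "y \<in> U 1 \<or> y \<in> U (-1)"
    using y p v by (auto simp: U_def UTH_iff)
  then show "\<exists>U s. openin (top_of_set UTH) U \<and> y \<in> U \<and>
      continuous_map (subtopology (top_of_set UTH) U) (top_of_set frames) s \<and>
      (\<forall>z\<in>U. frame_vector (s z) = z)"
  proof
    assume "y \<in> U 1"
    moreover obtain s where "continuous_map (subtopology (top_of_set UTH) (U 1)) (top_of_set frames) s"
        "\<forall>z\<in>U 1. frame_vector (s z) = z"
      using sections[of 1 \<i>] by auto
    ultimately show ?thesis
      using ope by blast
  next
    assume "y \<in> U (-1)"
    moreover obtain s where "continuous_map (subtopology (top_of_set UTH) (U (-1))) (top_of_set frames) s"
        "\<forall>z\<in>U (-1). frame_vector (s z) = z"
      using sections[of "-1" 1] by auto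
    ultimately show ?thesis
      using ope by blast
  qed
qed

text \<open>The quotient rule leaves the determinant 1 in the numerator, and the real derivative is
  multiplication by the complex one.\<close>

lemma frechet_derivative_moebius:
  assumes "det A = 1" "Im p > 0"
  shows "frechet_derivative (moebius A) (at p) v = v / (automorphy A p)\<^sup>2"
proof -
  have nz: "of_real (A $ 2 $ 1) * p + of_real (A $ 2 $ 2) \<noteq> (0::complex)"
    using automorphy_nonzero[OF assms] by (simp add: automorphy_def)
  have det: "complex_of_real (A $ 1 $ 1) * of_real (A $ 2 $ 2) - of_real (A $ 1 $ 2) * of_real (A $ 2 $ 1) = 1"
    using assms(1) by (simp add: det_2 flip: of_real_mult of_real_diff)
  have "(moebius A has_field_derivative 1 / (automorphy A p)\<^sup>2) (at p)"
    unfolding moebius_def[abs_def] automorphy_def power2_eq_square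
    by (rule derivative_eq_intros refl nz)+ (use det in \<open>simp add: algebra_simps\<close>)
  then have "(moebius A has_derivative (\<lambda>v. 1 / (automorphy A p)\<^sup>2 * v)) (at p)"
    by (rule has_field_derivative_imp_has_derivative)
  from frechet_derivative_at[OF this, symmetric] show ?thesis
    by simp
qed

text \<open>With j = \<open>automorphy A p\<close>, the imaginary part is divided by j * cnj j while
  cnj w / w gains the factor cnj j / j. Together this is j^(-2), the factor of the
  derivative.\<close>

lemma UTH_act_frame_vector:
  assumes A: "det A = 1" and x: "x \<in> frames"
  shows "UTH_act A (frame_vector x) = frame_vector (frame_act A x)"
proof -
  obtain p w where x': "x = (p, w)" "Im p > 0" "w \<noteq> 0"
    using x by (auto simp: frames_def)
  let ?j = "automorphy A p"
  have j: "?j \<noteq> 0" "cnj ?j \<noteq> 0"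
    using automorphy_nonzero[OF A x'(2)] by simp_all
  have "of_real (Im (moebius A p)) = of_real (Im p) / (?j * cnj ?j)"
    by (simp only: Im_moebius[OF A x'(2)] of_real_divide complex_norm_square)
  then have "of_real (Im (moebius A p)) * cnj (w * ?j) / (w * ?j) =
      of_real (Im p) * cnj w / w / ?j\<^sup>2"
    using j x'(3) by (simp add: power2_eq_square)
  then show ?thesis
    by (simp add: x' UTH_act_def frame_vector_def frame_act_def frechet_derivative_moebius A)
qed

text \<open>Equality of the vectors says that w' / w is its own conjugate.\<close>

lemma frame_vector_eq_iff:
  assumes "(p, w) \<in> frames" "(p', w') \<in> frames"
  shows "frame_vector (p, w) = frame_vector (p', w') \<longleftrightarrow> p = p' \<and> (\<exists>t::real. t \<noteq> 0 \<and> w' = of_real t * w)"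
proof
  assume "frame_vector (p, w) = frame_vector (p', w')"
  then have p: "p = p'" and "of_real (Im p) * (cnj w / w) = of_real (Im p) * (cnj w' / w')"
    using assms by (auto simp: frame_vector_def)
  then have "cnj w / w = cnj w' / w'"
    using assms by (simp add: frames_def del: times_divide_eq_right)
  then have "cnj (w' / w) = w' / w"
    using assms by (auto simp: frames_def field_simps)
  then obtain t where "w' / w = of_real t"
    by (metis Reals_cases Reals_cnj_iff)
  then have "w' = of_real t * w" "t \<noteq> 0"
    using assms by (auto simp: frames_def field_simps)
  with p show "p = p' \<and> (\<exists>t::real. t \<noteq> 0 \<and> w' = of_real t * w)"
    by blast
qed (use assms in \<open>auto simp: frame_vector_def frames_def\<close>)

lemma psl_presentation_UTH:
  "psl_presentation (top_of_set frames) frame_act UTH_top UTH_act frame_vector"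
  by (rule psl_presentation_frames)
    (auto simp: quotient_map_frame_vector UTH_act_frame_vector, simp add: frame_vector_def)

section \<open>Projective space\<close>

lemma proj_class_eq_iff: "proj_class v = proj_class v' \<longleftrightarrow> (\<exists>k. k \<noteq> 0 \<and> v' = k *s v)"
proof
  have "v' = 1 *s v'"
    by simp
  then have "v' \<in> proj_class v'"
    unfolding proj_class_def using zero_neq_one by (metis (mono_tags, lifting) mem_Collect_eq)
  moreover assume "proj_class v = proj_class v'"
  ultimately show "\<exists>k. k \<noteq> 0 \<and> v' = k *s v"
    by (auto simp: proj_class_def)
next
  assume "\<exists>k. k \<noteq> 0 \<and> v' = k *s v"
  then obtain k where k: "k \<noteq> 0" "v' = k *s v"
    by blast
  show "proj_class v = proj_class v'"
  proof (rule Set.set_eqI)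
    fix u
    have "(\<exists>l. l \<noteq> 0 \<and> u = l *s v) \<longleftrightarrow> (\<exists>l. l \<noteq> 0 \<and> u = (l * k) *s v)"
      using k(1) by (metis divide_eq_0_iff mult_eq_0_iff nonzero_divide_eq_eq)
    then show "u \<in> proj_class v \<longleftrightarrow> u \<in> proj_class v'"
      by (auto simp: proj_class_def k vector_smult_assoc)
  qed
qed

lemma proj_class_smult: "k \<noteq> 0 \<Longrightarrow> proj_class (k *s v) = proj_class v"
  by (metis proj_class_eq_iff)

lemma quotient_map_proj_class:
  "quotient_map (top_of_set (UNIV - {0})) projective_space proj_class"
  unfolding projective_space_def by (rule quotient_map_quotient_topology)


section \<open>Cubics with negative discriminant\<close>

text \<open>The coefficients of (x^2 - 2 Re p x y + |p|^2 y^2) (Re w x - Re (w p) y).\<close>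

definition frame_cubic :: "complex \<times> complex \<Rightarrow> real ^ 4" where
  "frame_cubic = (\<lambda>(p, w). \<chi> i.
     if i = 1 then Re w
     else if i = 2 then - Re (w * p) - 2 * Re p * Re w
     else if i = 3 then (cmod p)\<^sup>2 * Re w + 2 * Re p * Re (w * p)
     else - (cmod p)\<^sup>2 * Re (w * p))"

lemma frame_cubic_nth [simp]:
  "frame_cubic (p, w) $ 1 = Re w"
  "frame_cubic (p, w) $ 2 = - Re (w * p) - 2 * Re p * Re w"
  "frame_cubic (p, w) $ 3 = (cmod p)\<^sup>2 * Re w + 2 * Re p * Re (w * p)"
  "frame_cubic (p, w) $ 4 = - (cmod p)\<^sup>2 * Re (w * p)"
  by (simp_all add: frame_cubic_def)

lemma cubic_form_frame_cubic:
  "cubic_form (frame_cubic (p, w)) u =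
    (cmod (of_real (u $ 1) - p * of_real (u $ 2)))\<^sup>2 * Re (w * (of_real (u $ 1) - p * of_real (u $ 2)))"
  unfolding cubic_form_def frame_cubic_nth cmod_power2
  by (simp add: power2_eq_square power3_eq_cube algebra_simps)

lemma cubic_form_smult: "cubic_form (k *s f) u = k * cubic_form f u"
  by (simp add: cubic_form_def algebra_simps)

text \<open>Values at (1, 0) and (0, 1) give the outer coefficients; those at (1, 1) and (1, -1)
  then give sum and difference of the inner ones.\<close>

lemma cubic_form_inject: "cubic_form f = cubic_form g \<longleftrightarrow> f = g"
proof
  assume eq: "cubic_form f = cubic_form g"
  have coeff: "cubic_form f (vector [x, y]) = cubic_form g (vector [x, y])" for x y
    by (simp add: eq)
  show "f = g"
    using coeff[of 1 0] coeff[of 0 1] coeff[of 1 1] coeff[of 1 "-1"]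
    by (simp add: cubic_form_def vec_eq_iff forall_4)
qed simp

lemma frame_cubic_smult: "frame_cubic (p, of_real t * w) = t *s frame_cubic (p, w)"
  by (simp add: vec_eq_iff forall_4 algebra_simps)

text \<open>At y = 1 the cubic factors as (z - p) (z - cnj p) L(z) with L linear and real.
  Evaluating the factorisation for (p', w') at p leaves p = p' or p = cnj p', as a nonzero real L
  has no nonreal root. The half plane decides, and the first two coefficients give Re w and Re (w
  p), hence w.\<close>

lemma frame_cubic_inject:
  assumes pw: "(p, w) \<in> frames" and pw': "(p', w') \<in> frames"
    and eq: "frame_cubic (p, w) = frame_cubic (p', w')"
  shows "p = p' \<and> w = w'"
proof -
  let ?L = "\<lambda>p w z. of_real (Re w) * z - of_real (Re (w * p)) :: complex"
  let ?C = "\<lambda>p w z. (z - p) * (z - cnj p) * ?L p w z"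
  have expand: "?C p w z = of_real (frame_cubic (p, w) $ 1) * z ^ 3 + of_real (frame_cubic (p, w) $ 2) * z\<^sup>2
      + of_real (frame_cubic (p, w) $ 3) * z + of_real (frame_cubic (p, w) $ 4)" for p w z
  proof -
    have "(z - p) * (z - cnj p) = z * z - (p + cnj p) * z + p * cnj p"
      by (simp add: algebra_simps)
    also have "\<dots> = z * z - of_real (2 * Re p) * z + of_real ((cmod p)\<^sup>2)"
      unfolding complex_add_cnj complex_norm_square ..
    finally show ?thesis
      by (simp only:) (simp add: power2_eq_square power3_eq_cube algebra_simps)
  qed
  have L_nz: "?L p' w' p \<noteq> 0"
  proof
    assume "?L p' w' p = 0"
    then have "Re w' * Im p = 0" "Re w' * Re p = Re (w' * p')"
      by (auto simp: complex_eq_iff)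
    with pw pw' show False
      by (auto simp: frames_def complex_eq_iff)
  qed
  have "?C p' w' p = ?C p w p"
    unfolding expand eq ..
  also have "\<dots> = 0"
    by simp
  finally have "p = p' \<or> p = cnj p'"
    using L_nz by simp
  then have p: "p = p'"
    using pw pw' by (auto simp: frames_def)
  have "Re w = Re w'"
    using arg_cong[OF eq, of "\<lambda>f. f $ 1"] by simp
  moreover from this have "Re (w * p) = Re (w' * p)"
    using arg_cong[OF eq, of "\<lambda>f. f $ 2"] by (simp add: p)
  ultimately have "w = w'"
    using pw by (auto simp: frames_def complex_eq_iff)
  with p show ?thesis
    by simp
qed

section \<open>Discriminants of products, and surjectivity onto the cone of cubics\<close>

definition Delta_cone :: "(real ^ 4) set" where
  "Delta_cone = {f. disc3 (f $ 1) (f $ 2) (f $ 3) (f $ 4) < 0}"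

text \<open>The discriminant of a product is disc(Q) Res(Q, L)^2, for Q = k x^2 + e x y + g y^2 and
  L = s x + t y; up to sign the resultant is Q(t, -s).\<close>

lemma disc3_product:
  fixes k e g s t :: real
  shows "disc3 (k * s) (e * s + k * t) (g * s + e * t) (g * t) =
    (e\<^sup>2 - 4 * k * g) * (k * t\<^sup>2 - e * s * t + g * s\<^sup>2)\<^sup>2"
  unfolding disc3_def
  by (simp add: power2_eq_square power3_eq_cube algebra_simps)

text \<open>The resultant is |p Re w - Re (w p)|^2, and p Re w - Re (w p) = Im p (Im w + i Re
  w).\<close>

lemma disc3_frame_cubic:
  "disc3 (frame_cubic (p, w) $ 1) (frame_cubic (p, w) $ 2) (frame_cubic (p, w) $ 3) (frame_cubic (p, w) $ 4) =
    - 4 * (Im p)\<^sup>2 * ((Im p)\<^sup>2 * (cmod w)\<^sup>2)\<^sup>2"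
proof -
  have "(- 2 * Re p)\<^sup>2 - 4 * 1 * (cmod p)\<^sup>2 = - 4 * (Im p)\<^sup>2"
    unfolding cmod_power2 by (simp add: algebra_simps power2_eq_square)
  moreover have "1 * (- Re (w * p))\<^sup>2 - (- 2 * Re p) * Re w * (- Re (w * p)) + (cmod p)\<^sup>2 * (Re w)\<^sup>2 =
      (Im p)\<^sup>2 * (cmod w)\<^sup>2"
    unfolding cmod_power2 by (simp add: algebra_simps power2_eq_square)
  moreover have "frame_cubic (p, w) $ 1 = 1 * Re w"
      "frame_cubic (p, w) $ 2 = (- 2 * Re p) * Re w + 1 * (- Re (w * p))"
      "frame_cubic (p, w) $ 3 = (cmod p)\<^sup>2 * Re w + (- 2 * Re p) * (- Re (w * p))"
      "frame_cubic (p, w) $ 4 = (cmod p)\<^sup>2 * (- Re (w * p))"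
    unfolding frame_cubic_nth by (simp_all add: algebra_simps)
  ultimately show ?thesis
    by (simp only: disc3_product)
qed

lemma frame_cubic_in_Delta_cone: "x \<in> frames \<Longrightarrow> frame_cubic x \<in> Delta_cone"
  by (cases x) (simp add: Delta_cone_def disc3_frame_cubic frames_def del: frame_cubic_nth)

text \<open>A negative discriminant makes the quadratic factor definite and the linear factor
  nonzero. The upper root of the former is p; its leading coefficient k is absorbed into w.\<close>

lemma frame_cubic_product:
  fixes k e g s t :: real and f :: "real ^ 4"
  assumes f: "f $ 1 = k * s" "f $ 2 = e * s + k * t" "f $ 3 = g * s + e * t" "f $ 4 = g * t"
    and neg: "f \<in> Delta_cone"
  shows "f \<in> frame_cubic ` frames"
proof -
  have "(e\<^sup>2 - 4 * k * g) * (k * t\<^sup>2 - e * s * t + g * s\<^sup>2)\<^sup>2 < 0"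
    using neg by (simp add: Delta_cone_def f disc3_product)
  then have D: "4 * k * g - e\<^sup>2 > 0" and st: "s \<noteq> 0 \<or> t \<noteq> 0"
    by (auto simp: mult_less_0_iff)
  then have k: "k \<noteq> 0"
    by auto
  \<comment> \<open>p = m + n i is the root of k z^2 + e z + g in the upper half plane: m is half
    the sum of the roots, and m^2 + n^2 is their product g / k.\<close>
  define m where "m = - e / (2 * k)"
  define n where "n = sqrt (g / k - m\<^sup>2)"
  have "g / k - m\<^sup>2 = (4 * k * g - e\<^sup>2) / (4 * k\<^sup>2)"
    using k by (simp add: m_def field_simps power2_eq_square)
  also have "\<dots> > 0"
    using D k by simp
  finally have n: "n > 0" "n\<^sup>2 = g / k - m\<^sup>2"
    by (simp_all add: n_def)
  define p where "p = Complex m n"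
  \<comment> \<open>The solution of the linear equations Re w = k s and Re (w p) = - k t.\<close>
  define w where "w = Complex (k * s) ((k * t + m * (k * s)) / n)"
  have "w \<noteq> 0"
    using st k n by (auto simp: w_def complex_eq_iff)
  then have "(p, w) \<in> frames"
    using n by (simp add: frames_def p_def)
  moreover have wp: "Re (w * p) = - k * t"
    using n by (simp add: w_def p_def field_simps)
  have np: "(cmod p)\<^sup>2 = g / k"
    using n by (simp add: p_def cmod_power2)
  have "f = frame_cubic (p, w)"
    unfolding vec_eq_iff forall_4 frame_cubic_nth wp np f
    using k by (simp add: w_def p_def m_def field_simps)
  ultimately show ?thesis
    by blast
qed

text \<open>Intermediate value theorem on [-M, M]. At both ends the lower terms are bounded by (M -
  1) M^2, hence by |x|^3, so the value is \<le> 0 at -M and \<ge> 0 at M.\<close>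

lemma real_cubic_root:
  fixes b c d :: real
  obtains r where "r ^ 3 + b * r\<^sup>2 + c * r + d = 0"
proof -
  let ?g = "\<lambda>x. x ^ 3 + b * x\<^sup>2 + c * x + d"
  define M where "M = 1 + \<bar>b\<bar> + \<bar>c\<bar> + \<bar>d\<bar>"
  have M: "M \<ge> 1"
    by (simp add: M_def)
  have bound: "\<bar>b * x\<^sup>2 + c * x + d\<bar> \<le> M ^ 3" if "\<bar>x\<bar> = M" for x
  proof -
    have M2: "1 \<le> M\<^sup>2" "M \<le> M\<^sup>2"
      using M one_le_power[OF M, of 2] mult_left_mono[OF M, of M]
      by (simp, simp add: power2_eq_square)
    have "\<bar>b * x\<^sup>2\<bar> = \<bar>b\<bar> * M\<^sup>2" "\<bar>c * x\<bar> = \<bar>c\<bar> * M"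
      by (simp_all only: abs_mult power_abs that)
    moreover have "\<bar>c\<bar> * M \<le> \<bar>c\<bar> * M\<^sup>2"
      using M2(2) by (rule mult_left_mono) simp
    moreover have "\<bar>d\<bar> \<le> \<bar>d\<bar> * M\<^sup>2"
      using mult_left_mono[OF M2(1), of "\<bar>d\<bar>"] by simp
    moreover have "(M - 1) * M\<^sup>2 = \<bar>b\<bar> * M\<^sup>2 + \<bar>c\<bar> * M\<^sup>2 + \<bar>d\<bar> * M\<^sup>2"
      by (simp add: M_def ring_distribs(2))
    ultimately have "\<bar>b * x\<^sup>2\<bar> + \<bar>c * x\<bar> + \<bar>d\<bar> \<le> (M - 1) * M\<^sup>2"
      by linarith
    moreover have "\<bar>b * x\<^sup>2 + c * x + d\<bar> \<le> \<bar>b * x\<^sup>2\<bar> + \<bar>c * x\<bar> + \<bar>d\<bar>"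
      by linarith
    ultimately have "\<bar>b * x\<^sup>2 + c * x + d\<bar> \<le> (M - 1) * M\<^sup>2"
      by linarith
    also have "\<dots> \<le> M ^ 3"
      using M by (simp add: power3_eq_cube power2_eq_square algebra_simps)
    finally show ?thesis .
  qed
  have "\<exists>x. - M \<le> x \<and> x \<le> M \<and> ?g x = 0"
    using bound[of M] bound[of "- M"] M
    by (intro IVT') (auto intro!: continuous_intros)
  then show ?thesis
    using that by blast
qed

lemma Delta_cone_subset_image: "Delta_cone \<subseteq> frame_cubic ` frames"
proof
  fix f assume f: "f \<in> Delta_cone"
  show "f \<in> frame_cubic ` frames"
  proof (cases "f $ 1 = 0")
    case True
    \<comment> \<open>The real root is the point at infinity, with linear factor y.\<close>
    then show ?thesis
      using f by (intro frame_cubic_product[of f "f $ 2" 0 "f $ 3" 1 "f $ 4"]) auto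
  next
    case False
    obtain r where r: "r ^ 3 + f $ 2 / f $ 1 * r\<^sup>2 + f $ 3 / f $ 1 * r + f $ 4 / f $ 1 = 0"
      by (rule real_cubic_root)
    \<comment> \<open>Horner's scheme: e and g are the lower coefficients of the quotient by x - r
      y. The vanishing remainder says that \<open>f $ 4\<close> is - g r.\<close>
    define e where "e = f $ 2 + f $ 1 * r"
    define g where "g = f $ 3 + e * r"
    have "f $ 4 = f $ 1 * (f $ 4 / f $ 1)"
      using False by simp
    also have "f $ 4 / f $ 1 = - (r ^ 3 + f $ 2 / f $ 1 * r\<^sup>2 + f $ 3 / f $ 1 * r)"
      using r by linarith
    also have "f $ 1 * \<dots> = g * (- r)"
      using False by (simp add: g_def e_def power2_eq_square power3_eq_cube field_simps)
    finally show ?thesis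
      using f by (intro frame_cubic_product[of f "f $ 1" 1 e "- r" g])
        (auto simp: g_def e_def algebra_simps)
  qed
qed

lemma frame_cubic_image: "frame_cubic ` frames = Delta_cone"
  using Delta_cone_subset_image frame_cubic_in_Delta_cone by blast

lemma continuous_frame_cubic: "continuous_on S frame_cubic"
proof -
  have "continuous_on S (\<lambda>x. frame_cubic x $ i)" for i
    unfolding frame_cubic_def case_prod_unfold vec_lambda_beta
    by (cases "i = 1"; cases "i = 2"; cases "i = 3") (auto intro!: continuous_intros)
  then have "continuous_on S (\<lambda>x. \<chi> i. frame_cubic x $ i)"
    by (rule continuous_on_vec_lambda)
  then show ?thesis
    by simp
qed

lemma quotient_map_frame_cubic:
  "quotient_map (top_of_set frames) (top_of_set Delta_cone) frame_cubic"
proof (rule continuous_open_imp_quotient_map)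
  have inj: "inj_on frame_cubic frames"
    by (auto simp: inj_on_def dest: frame_cubic_inject)
  show "open_map (top_of_set frames) (top_of_set Delta_cone) frame_cubic"
    unfolding open_map_def
  proof (intro allI impI)
    fix U assume "openin (top_of_set frames) U"
    then have U: "open U" "U \<subseteq> frames"
      by (auto simp: openin_open_eq[OF open_frames])
    then have "open (frame_cubic ` U)"
      using inj_on_subset[OF inj] by (intro invariance_of_domain_gen continuous_frame_cubic) auto
    then show "openin (top_of_set Delta_cone) (frame_cubic ` U)"
      using U frame_cubic_in_Delta_cone by (intro open_subset) auto
  qed
qed (auto simp: frame_cubic_image continuous_frame_cubic frame_cubic_in_Delta_cone)

section \<open>From cubics to their projective classes\<close>

lemma open_Delta_cone: "open Delta_cone"
  unfolding Delta_cone_def disc3_def by (intro open_Collect_less continuous_intros)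

text \<open>The discriminant is homogeneous of even degree four, so its sign is constant on a
  class.\<close>

lemma proj_class_in_Delta_minus_iff: "proj_class f \<in> Delta_minus \<longleftrightarrow> f \<in> Delta_cone"
proof -
  have "disc3 (k * a) (k * b) (k * c) (k * d) = k ^ 4 * disc3 a b c d" for k a b c d
    by (simp add: disc3_def power4_eq_xxxx power2_eq_square power3_eq_cube algebra_simps)
  then have scale: "k *s f \<in> Delta_cone \<longleftrightarrow> f \<in> Delta_cone" if "k \<noteq> 0" for k f
    using that by (simp add: Delta_cone_def mult_less_0_iff)
  have "proj_class f \<in> Delta_minus \<longleftrightarrow> (\<exists>f'\<in>Delta_cone. proj_class f = proj_class f')"
    by (auto simp: Delta_minus_def Delta_cone_def)
  then show ?thesis
    using scale by (metis proj_class_eq_iff)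
qed

text \<open>A quotient map restricts to a quotient map over an open subset of its target;
  \<open>Delta_minus\<close> is open because its cone is. The origin lies outside the cone, its
  discriminant being 0.\<close>

lemma quotient_map_frame_cubic_class:
  "quotient_map (top_of_set frames) Delta_minus_top (\<lambda>x. proj_class (frame_cubic x))"
proof -
  have sat: "{f \<in> topspace (top_of_set (UNIV - {0})). proj_class f \<in> Delta_minus} = Delta_cone"
    by (auto simp: proj_class_in_Delta_minus_iff) (simp add: Delta_cone_def disc3_def)
  have "Delta_minus \<subseteq> topspace RP3"
  proof
    fix P assume P: "P \<in> Delta_minus"
    then obtain f where "P = proj_class f"
      by (auto simp: Delta_minus_def)
    with P sat have "f \<in> UNIV - {0}" "P = proj_class f"
      by (auto simp: proj_class_in_Delta_minus_iff)
    then show "P \<in> topspace RP3"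
      using quotient_imp_surjective_map[OF quotient_map_proj_class] by auto
  qed
  then have "openin RP3 Delta_minus \<longleftrightarrow>
      openin (top_of_set (UNIV - {0})) {f \<in> topspace (top_of_set (UNIV - {0})). proj_class f \<in> Delta_minus}"
    using quotient_map_proj_class unfolding quotient_map_def by blast
  moreover have "openin (top_of_set (UNIV - {0})) Delta_cone"
    using open_Delta_cone sat by (intro open_subset) auto
  ultimately have "openin RP3 Delta_minus"
    by (simp only: sat)
  then have "quotient_map (subtopology (top_of_set (UNIV - {0})) Delta_cone)
      (subtopology RP3 Delta_minus) proj_class"
    by (intro quotient_map_restriction[OF quotient_map_proj_class sat]) simp
  moreover have "subtopology (top_of_set (UNIV - {0})) Delta_cone = top_of_set Delta_cone"
    using sat by (subst subtopology_subtopology) (auto intro!: arg_cong[where f = top_of_set])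
  ultimately show ?thesis
    using quotient_map_compose[OF quotient_map_frame_cubic] by (auto simp: Delta_minus_top_def o_def)
qed

text \<open>With j = \<open>automorphy A p\<close>, the form x - (A p) y takes at A u the value of
  (x - p y) / j at u. The factor j in the new w cancels one 1 / j, so the cubics differ by the
  scalar |j|^2, which the class forgets.\<close>

lemma cubic_act_frame_cubic:
  assumes A: "det A = 1" and x: "x \<in> frames"
  shows "cubic_act A (proj_class (frame_cubic x)) = proj_class (frame_cubic (frame_act A x))"
proof -
  obtain p w where x': "x = (p, w)" "Im p > 0" "w \<noteq> 0"
    using x by (auto simp: frames_def)
  let ?j = "automorphy A p"
  define N where "N = (cmod ?j)\<^sup>2"
  have j: "?j \<noteq> 0"
    using automorphy_nonzero[OF A x'(2)] .
  have lin: "?j * (of_real ((A *v u) $ 1) - moebius A p * of_real ((A *v u) $ 2)) =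
      of_real (u $ 1) - p * of_real (u $ 2)" (is "?j * ?M u = ?N u") for u
  proof -
    have det: "complex_of_real (A $ 1 $ 1) * of_real (A $ 2 $ 2) - of_real (A $ 1 $ 2) * of_real (A $ 2 $ 1) = 1"
      using A by (simp add: det_2 flip: of_real_mult of_real_diff)
    have "?j * ?M u = ?j * of_real ((A *v u) $ 1) - (moebius A p * ?j) * of_real ((A *v u) $ 2)"
      by (simp add: algebra_simps)
    also have "\<dots> = (of_real (A $ 1 $ 1) * of_real (A $ 2 $ 2) - of_real (A $ 1 $ 2) * of_real (A $ 2 $ 1)) * ?N u"
      unfolding moebius_times_automorphy[OF A x'(2)]
      by (simp add: automorphy_def matrix_vector_mult_2 algebra_simps)
    finally show ?thesis
      by (simp add: det)
  qed
  have form: "cubic_form (frame_cubic x) u = N * cubic_form (frame_cubic (frame_act A x)) (A *v u)" for u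
    unfolding x' frame_act_def prod.case cubic_form_frame_cubic
    by (simp add: N_def norm_mult power_mult_distrib mult.assoc flip: lin)
  obtain B where B: "A ** B = mat 1" "B ** A = mat 1"
    using SL2_inverse[OF A] by metis
  \<comment> \<open>\<open>matrix_inv\<close> is defined by choice; \<open>B\<close> shows that
    there is something to choose.\<close>
  have inv: "A ** matrix_inv A = mat 1"
    unfolding matrix_inv_def by (rule someI2[of _ B]) (use B in auto)
  have "cubic_form (k *s frame_cubic x) \<circ> (\<lambda>u. matrix_inv A *v u) =
      cubic_form ((k * N) *s frame_cubic (frame_act A x))" for k
    by (auto simp: fun_eq_iff cubic_form_smult form matrix_vector_mul_assoc inv)
  then have "cubic_act A (proj_class (frame_cubic x)) =
      {(k * N) *s frame_cubic (frame_act A x) |k. k \<noteq> 0}"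
    by (auto simp: cubic_act_def proj_class_def cubic_form_inject)
  also have "\<dots> = proj_class (N *s frame_cubic (frame_act A x))"
    by (simp add: proj_class_def)
  also have "\<dots> = proj_class (frame_cubic (frame_act A x))"
    using j by (simp add: N_def proj_class_smult)
  finally show ?thesis .
qed

lemma frame_cubic_class_eq_iff:
  assumes "(p, w) \<in> frames" "(p', w') \<in> frames"
  shows "proj_class (frame_cubic (p, w)) = proj_class (frame_cubic (p', w')) \<longleftrightarrow>
    p = p' \<and> (\<exists>t::real. t \<noteq> 0 \<and> w' = of_real t * w)"
proof -
  have "frame_cubic (p', w') = t *s frame_cubic (p, w) \<longleftrightarrow> p = p' \<and> w' = of_real t * w"
    if "t \<noteq> 0" for t :: real
  proof -
    have "(p, of_real t * w) \<in> frames"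
      using assms(1) that by (simp add: frames_def)
    then show ?thesis
      using frame_cubic_inject[OF assms(2)] by (auto simp flip: frame_cubic_smult)
  qed
  then show ?thesis
    by (auto simp: proj_class_eq_iff)
qed

lemma psl_presentation_Delta_minus:
  "psl_presentation (top_of_set frames) frame_act Delta_minus_top cubic_act
    (\<lambda>x. proj_class (frame_cubic x))"
proof (rule psl_presentation_frames[OF quotient_map_frame_cubic_class cubic_act_frame_cubic])
  fix p w assume "(p, w) \<in> frames"
  moreover have "- w = of_real (-1) * w"
    by simp
  ultimately show "proj_class (frame_cubic (p, - w)) = proj_class (frame_cubic (p, w))"
    using frame_cubic_smult[of p "-1" w] by (auto simp: proj_class_eq_iff intro!: exI[of _ "-1"])
qed

section \<open>Root sets\<close>

text \<open>The saturation of \<open>U\<close> is the union of its preimages under all nonzero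
  scalings, each of them open.\<close>

lemma openin_proj_class_image:
  fixes U :: "('a::{field,real_normed_algebra} ^ 'n) set"
  assumes "open U" "0 \<notin> U"
  shows "openin projective_space (proj_class ` U)"
proof -
  let ?pre = "{v \<in> topspace (top_of_set (UNIV - {0})). proj_class v \<in> proj_class ` U}"
  have "?pre = (\<Union>k\<in>- {0}. {v. k *s v \<in> U})"
    using assms(2) by (auto simp: image_iff proj_class_eq_iff)
  moreover have "open {v. k *s v \<in> U}" for k :: 'a
    using open_vimage[OF assms(1), of "\<lambda>v. k *s v"]
    by (simp add: vimage_def vector_scalar_mult_def continuous_intros)
  ultimately have "open ?pre"
    by auto
  then have "openin (top_of_set (UNIV - {0})) ?pre"
    by (intro open_subset) auto
  moreover have "proj_class ` U \<subseteq> proj_class ` topspace (top_of_set (UNIV - {0}))"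
    using assms(2) by (intro image_mono) auto
  ultimately show ?thesis
    unfolding projective_space_def openin_quotient_topology by blast
qed

text \<open>The set is the image of the open cone of vectors whose coordinate ratio lies in
  \<open>B\<close>.\<close>

lemma openin_cp1_of_image:
  assumes "open B"
  shows "openin CP1 (cp1_of ` B)"
proof -
  let ?U = "{v :: complex ^ 2. v $ 2 \<noteq> 0 \<and> v $ 1 / v $ 2 \<in> B}"
  have "open {v :: complex ^ 2. v $ 2 \<noteq> 0}"
    by (intro open_Collect_neq continuous_intros)
  moreover have "?U = {v. v $ 2 \<noteq> 0} \<inter> (\<lambda>v. v $ 1 / v $ 2) -` B"
    by auto
  ultimately have "open ?U"
    using assms by (auto intro!: continuous_open_preimage continuous_intros)
  moreover have "proj_class v = cp1_of (v $ 1 / v $ 2)" if "v $ 2 \<noteq> 0" for v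
    unfolding cp1_of_def proj_class_eq_iff using that
    by (intro exI[of _ "inverse (v $ 2)"]) (auto simp: vec_eq_iff forall_2 field_simps)
  then have "proj_class ` ?U \<subseteq> cp1_of ` B"
    by auto
  moreover have "cp1_of z \<in> proj_class ` ?U" if "z \<in> B" for z
    unfolding cp1_of_def using that by (intro imageI) simp
  ultimately have "open ?U" "proj_class ` ?U = cp1_of ` B"
    by blast+
  then show ?thesis
    using openin_proj_class_image[of ?U] by simp
qed

lemma cp1_of_inject [simp]: "cp1_of z = cp1_of z' \<longleftrightarrow> z = z'"
  by (auto simp: cp1_of_def proj_class_eq_iff vec_eq_iff forall_2)

lemma RP1_in_CP1I: "(x, y) \<noteq> (0, 0) \<Longrightarrow> proj_class (vector [of_real x, of_real y]) \<in> RP1_in_CP1"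
  unfolding RP1_in_CP1_def by (rule CollectI, rule exI[of _ x], rule exI[of _ y]) (rule conjI, rule refl)

lemma cp1_of_in_RP1_iff: "cp1_of z \<in> RP1_in_CP1 \<longleftrightarrow> z \<in> \<real>"
proof
  assume "cp1_of z \<in> RP1_in_CP1"
  then obtain x y :: real where "of_real x = of_real y * z" "y \<noteq> 0"
    by (auto simp: RP1_in_CP1_def cp1_of_def proj_class_eq_iff vec_eq_iff forall_2)
  then have "z = of_real (x / y)"
    by simp
  then show "z \<in> \<real>"
    by simp
next
  assume "z \<in> \<real>"
  then have "cp1_of z = proj_class (vector [of_real (Re z), of_real 1])"
    by (simp add: cp1_of_def)
  then show "cp1_of z \<in> RP1_in_CP1"
    by (simp only:) (rule RP1_in_CP1I, simp)
qed

text \<open>Filtering by membership in RP^1 isolates the real entry, and the sign of the imaginary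
  part separates the other two. An unordered triple of roots can thus be read as an ordered
  one.\<close>

lemma root_multiset_eqD:
  assumes eq: "{#r, cp1_of z, cp1_of u#} = {#a, cp1_of z', cp1_of u'#}"
    and r: "r \<in> RP1_in_CP1" and z: "Im z > 0" "Im u < 0" "Im z' > 0" "Im u' < 0"
  shows "a = r \<and> z' = z \<and> u' = u"
proof -
  have nonreal: "cp1_of v \<notin> RP1_in_CP1" if "Im v \<noteq> 0" for v
    using that by (auto simp: cp1_of_in_RP1_iff complex_is_Real_iff)
  have "filter_mset (\<lambda>L. L \<in> RP1_in_CP1) {#r, cp1_of z, cp1_of u#} =
      filter_mset (\<lambda>L. L \<in> RP1_in_CP1) {#a, cp1_of z', cp1_of u'#}"
    by (simp only: eq)
  then have "a = r"
    using r z nonreal by (auto split: if_splits)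
  with eq have "{#cp1_of z, cp1_of u#} = {#cp1_of z', cp1_of u'#}"
    by simp
  with z have "z' = z \<and> u' = u"
    by (auto simp: add_eq_conv_ex)
  with \<open>a = r\<close> show ?thesis
    by simp
qed

text \<open>The preimage among ordered triples is the union of the six boxes that arise by permuting
  \<open>A\<close>, \<open>B\<close> and \<open>C\<close>.\<close>

lemma openin_SP3_box:
  assumes "openin X A" "openin X B" "openin X C"
  shows "openin (SP3 X) {{#a, b, c#} | a b c. a \<in> A \<and> b \<in> B \<and> c \<in> C}"
proof -
  define W where "W = {{#a, b, c#} | a b c. a \<in> A \<and> b \<in> B \<and> c \<in> C}"
  let ?XXX = "prod_topology X (prod_topology X X)"
  let ?q = "\<lambda>(p, q, r). {#p, q, r#}"
  have sub: "A \<subseteq> topspace X" "B \<subseteq> topspace X" "C \<subseteq> topspace X"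
    using assms openin_subset by auto
  have perms: "{#a, b, c#} \<in> W" "{#a, c, b#} \<in> W" "{#b, a, c#} \<in> W"
      "{#b, c, a#} \<in> W" "{#c, a, b#} \<in> W" "{#c, b, a#} \<in> W"
    if "a \<in> A" "b \<in> B" "c \<in> C" for a b c
  proof -
    show W: "{#a, b, c#} \<in> W"
      unfolding W_def using that by blast
    have "{#a, c, b#} = {#a, b, c#}" "{#b, a, c#} = {#a, b, c#}" "{#b, c, a#} = {#a, b, c#}"
        "{#c, a, b#} = {#a, b, c#}" "{#c, b, a#} = {#a, b, c#}"
      by (simp_all add: add_mset_commute)
    with W show "{#a, c, b#} \<in> W" "{#b, a, c#} \<in> W" "{#b, c, a#} \<in> W" "{#c, a, b#} \<in> W"
        "{#c, b, a#} \<in> W"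
      by (simp_all only:)
  qed
  have "{x \<in> topspace ?XXX. ?q x \<in> W} =
      A \<times> B \<times> C \<union> A \<times> C \<times> B \<union> B \<times> A \<times> C \<union> B \<times> C \<times> A \<union> C \<times> A \<times> B \<union> C \<times> B \<times> A"
    (is "?L = ?R")
  proof (intro subset_antisym subsetI)
    fix x assume "x \<in> ?L"
    then obtain p q r a b c where "x = (p, q, r)" "{#p, q, r#} = {#a, b, c#}" "a \<in> A" "b \<in> B" "c \<in> C"
      by (auto simp: W_def)
    then show "x \<in> ?R"
      by (auto simp: add_eq_conv_ex)
  next
    fix x assume "x \<in> ?R"
    then show "x \<in> ?L"
      using sub by (elim UnE SigmaE) (simp_all add: perms subsetD)
  qed
  moreover have "openin ?XXX ?R"
    using assms by (intro openin_Un) (auto simp: openin_prod_Times_iff)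
  moreover have "W \<subseteq> ?q ` topspace ?XXX"
  proof
    fix M assume "M \<in> W"
    then obtain a b c where "M = ?q (a, b, c)" "a \<in> A" "b \<in> B" "c \<in> C"
      by (auto simp: W_def)
    then show "M \<in> ?q ` topspace ?XXX"
      using sub by (intro image_eqI[of _ _ "(a, b, c)"]) auto
  qed
  ultimately show ?thesis
    unfolding SP3_def openin_quotient_topology W_def[symmetric] by (simp only: simp_thms)
qed

section \<open>Frames and their root multisets\<close>

definition frame_end :: "complex \<times> complex \<Rightarrow> (complex ^ 2) set" where
  "frame_end = (\<lambda>(p, w). proj_class (vector [of_real (Re (w * p)), of_real (Re w)]))"

definition frame_roots :: "complex \<times> complex \<Rightarrow> (complex ^ 2) set multiset" where
  "frame_roots = (\<lambda>(p, w). {#frame_end (p, w), cp1_of p, cp1_of (cnj p)#})"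

text \<open>For fixed p in the upper half plane, w -> (Re (w p), Re w) is a real linear isomorphism
  onto the plane; this is its inverse, with p kept as a parameter.\<close>

definition frame_of_end :: "(real \<times> real) \<times> complex \<Rightarrow> complex \<times> complex" where
  "frame_of_end = (\<lambda>((x, y), p). (p, Complex y ((y * Re p - x) / Im p)))"

lemma frame_of_end_Re:
  assumes "Im p > 0"
  shows "frame_of_end ((Re (w * p), Re w), p) = (p, w)"
  using assms by (simp add: frame_of_end_def complex_eq_iff field_simps)

lemma frame_end_of_end:
  assumes "Im p > 0"
  shows "frame_end (frame_of_end ((x, y), p)) = proj_class (vector [of_real x, of_real y])"
  using assms by (simp add: frame_end_def frame_of_end_def)

lemma frame_of_end_in_frames_iff:
  "Im p > 0 \<Longrightarrow> frame_of_end ((x, y), p) \<in> frames \<longleftrightarrow> (x, y) \<noteq> (0, 0)"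
  by (auto simp: frame_of_end_def frames_def complex_eq_iff)

lemma frame_end_vector_nonzero:
  assumes "(p, w) \<in> frames"
  shows "(Re (w * p), Re w) \<noteq> (0, 0)"
  using frame_of_end_in_frames_iff[of p "Re (w * p)" "Re w"] assms
  by (auto simp: frame_of_end_Re frames_def simp del: times_complex.sel)

lemma frame_end_in_RP1: "(p, w) \<in> frames \<Longrightarrow> frame_end (p, w) \<in> RP1_in_CP1"
  unfolding frame_end_def prod.case by (intro RP1_in_CP1I frame_end_vector_nonzero)

lemma frame_roots_image: "frame_roots ` frames = root_sets"
proof (intro subset_antisym subsetI)
  fix M assume "M \<in> frame_roots ` frames"
  then obtain p w where M: "M = frame_roots (p, w)" "(p, w) \<in> frames"
    by auto
  then have "p \<notin> \<real>"
    by (auto simp: frames_def complex_is_Real_iff)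
  with M(2) show "M \<in> root_sets"
    unfolding M(1) root_sets_def frame_roots_def prod.case
    by (intro CollectI exI conjI) (rule refl, erule frame_end_in_RP1)
next
  fix M assume "M \<in> root_sets"
  then obtain x y z where M: "M = {#proj_class (vector [of_real x, of_real y]), cp1_of z, cp1_of (cnj z)#}"
      "(x, y) \<noteq> (0, 0)" "Im z \<noteq> 0"
    by (auto simp: root_sets_def RP1_in_CP1_def complex_is_Real_iff)
  \<comment> \<open>The multiset does not distinguish z from its conjugate, so the upper one may
    serve as p.\<close>
  define p where "p = (if Im z > 0 then z else cnj z)"
  have p: "Im p > 0" "M = {#proj_class (vector [of_real x, of_real y]), cp1_of p, cp1_of (cnj p)#}"
    using M by (auto simp: p_def)
  then have "M = frame_roots (frame_of_end ((x, y), p))"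
    using frame_end_of_end[OF p(1)] by (simp add: frame_roots_def frame_of_end_def)
  then show "M \<in> frame_roots ` frames"
    using frame_of_end_in_frames_iff[OF p(1)] M by blast
qed

lemma continuous_map_proj_class_vector:
  fixes f g :: "'b::topological_space \<Rightarrow> 'a::{field,topological_space}"
  assumes "continuous_on S f" "continuous_on S g" "\<And>x. x \<in> S \<Longrightarrow> f x \<noteq> 0 \<or> g x \<noteq> 0"
  shows "continuous_map (top_of_set S) projective_space (\<lambda>x. proj_class (vector [f x, g x] :: 'a ^ 2))"
proof -
  have eq: "(vector [f x, g x] :: 'a ^ 2) = (\<chi> i. if i = 1 then f x else g x)" for x
    by (simp add: vec_eq_iff forall_2)
  have "continuous_on S (\<lambda>x. \<chi> i :: 2. if i = 1 then f x else g x)"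
  proof (rule continuous_on_vec_lambda)
    show "continuous_on S (\<lambda>x. if i = 1 then f x else g x)" for i :: 2
      using assms by (cases "i = 1") auto
  qed
  then have "continuous_map (top_of_set S) (top_of_set (UNIV - {0})) (\<lambda>x. vector [f x, g x] :: 'a ^ 2)"
    using assms(3) by (auto simp: eq vec_eq_iff) (metis zero_neq_one)
  from continuous_map_compose[OF this quotient_imp_continuous_map[OF quotient_map_proj_class]]
  show ?thesis
    by (simp only: o_def)
qed

lemma continuous_frame_roots: "continuous_map (top_of_set frames) root_sets_top frame_roots"
proof -
  have "continuous_map (top_of_set frames) CP1 frame_end"
    unfolding frame_end_def case_prod_unfold
    by (rule continuous_map_proj_class_vector)
      (use frame_end_vector_nonzero in \<open>auto intro!: continuous_intros simp del: times_complex.sel\<close>)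
  moreover have "continuous_map (top_of_set frames) CP1 (\<lambda>x. cp1_of (fst x))"
      "continuous_map (top_of_set frames) CP1 (\<lambda>x. cp1_of (cnj (fst x)))"
    unfolding cp1_of_def by (rule continuous_map_proj_class_vector; auto intro!: continuous_intros)+
  ultimately have "continuous_map (top_of_set frames) (prod_topology CP1 (prod_topology CP1 CP1))
      (\<lambda>x. (frame_end x, cp1_of (fst x), cp1_of (cnj (fst x))))"
    by (intro continuous_map_pairedI)
  then have "continuous_map (top_of_set frames) (SP3 CP1)
      ((\<lambda>(p, q, r). {#p, q, r#}) \<circ> (\<lambda>x. (frame_end x, cp1_of (fst x), cp1_of (cnj (fst x)))))"
    unfolding SP3_def
    by (rule continuous_map_compose) (rule quotient_imp_continuous_map[OF quotient_map_quotient_topology])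
  moreover have "(\<lambda>(p, q, r). {#p, q, r#}) \<circ> (\<lambda>x. (frame_end x, cp1_of (fst x), cp1_of (cnj (fst x)))) = frame_roots"
    by (auto simp: frame_roots_def)
  ultimately show ?thesis
    using frame_roots_image by (auto simp: root_sets_top_def continuous_map_in_subtopology)
qed

text \<open>In the coordinates of \<open>frame_of_end\<close>, a product of open sets controls the
  real root and p separately. The third factor of the box may be the whole lower half plane, since
  in \<open>root_sets\<close> the third root is the conjugate of p.\<close>

lemma open_map_frame_roots: "open_map (top_of_set frames) root_sets_top frame_roots"
  unfolding open_map_def
proof (intro allI impI)
  fix U assume "openin (top_of_set frames) U"
  then have U: "open U" "U \<subseteq> frames"
    by (auto simp: openin_open_eq[OF open_frames])
  let ?H = "UNIV \<times> {p. Im p > 0} :: ((real \<times> real) \<times> complex) set"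
  have "continuous_on ?H frame_of_end"
    unfolding frame_of_end_def case_prod_unfold Complex_eq
    by (auto intro!: continuous_intros)
  then have V: "open (?H \<inter> frame_of_end -` U)"
    using U(1) by (intro continuous_open_preimage open_Times open_UNIV open_halfspace_Im_gt)
  show "openin root_sets_top (frame_roots ` U)"
  proof (subst openin_subopen, intro ballI)
    fix M assume "M \<in> frame_roots ` U"
    then obtain p w where M: "M = frame_roots (p, w)" and pw: "(p, w) \<in> U"
      by auto
    with U have p: "Im p > 0" and pw': "(p, w) \<in> frames"
      by (auto simp: frames_def)
    then have "((Re (w * p), Re w), p) \<in> ?H \<inter> frame_of_end -` U"
      using pw by (simp add: frame_of_end_Re del: times_complex.sel)
    then obtain A B where AB: "open A" "open B" "((Re (w * p), Re w), p) \<in> A \<times> B"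
        "A \<times> B \<subseteq> ?H \<inter> frame_of_end -` U"
      using open_prod_elim[OF V] by metis
    have B: "Im p' > 0" if "p' \<in> B" for p'
      using AB that by auto
    have A0: "(0, 0) \<notin> A"
      using AB U frame_of_end_in_frames_iff[OF p, of 0 0] by auto
    \<comment> \<open>\<open>A\<close> consists of real pairs, whereas the box needs an open set of
      complex vectors; arbitrary imaginary parts are allowed.\<close>
    define N where "N = {v :: complex ^ 2. (Re (v $ 1), Re (v $ 2)) \<in> A}"
    have "open ((\<lambda>v :: complex ^ 2. (Re (v $ 1), Re (v $ 2))) -` A)"
      using AB(1) by (intro open_vimage continuous_intros)
    then have N: "openin CP1 (proj_class ` N)"
      using A0 by (intro openin_proj_class_image) (auto simp: N_def vimage_def)
    define W where "W = {{#a, b, c#} | a b c.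
        a \<in> proj_class ` N \<and> b \<in> cp1_of ` B \<and> c \<in> cp1_of ` {z. Im z < 0}}"
    have "openin (SP3 CP1) W"
      unfolding W_def
      by (intro openin_SP3_box N openin_cp1_of_image AB open_halfspace_Im_lt)
    then have "openin root_sets_top (root_sets \<inter> W)"
      unfolding root_sets_top_def by (rule openin_subtopology_Int2)
    moreover have "M \<in> W"
      unfolding W_def M frame_roots_def frame_end_def prod.case using AB p
      by (intro CollectI exI conjI imageI refl) (auto simp: N_def)
    then have "M \<in> root_sets \<inter> W"
      using pw' frame_roots_image M by auto
    moreover have "root_sets \<inter> W \<subseteq> frame_roots ` U"
    proof
      fix M' assume M': "M' \<in> root_sets \<inter> W"
      then obtain p' w' where p': "M' = frame_roots (p', w')" "(p', w') \<in> frames"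
        using frame_roots_image by (metis IntD1 imageE surj_pair)
      obtain v z u where vzu: "M' = {#proj_class v, cp1_of z, cp1_of u#}" "v \<in> N" "z \<in> B" "Im u < 0"
        using M' by (auto simp: W_def)
      have "{#frame_end (p', w'), cp1_of p', cp1_of (cnj p')#} = {#proj_class v, cp1_of z, cp1_of u#}"
        using p' vzu by (simp add: frame_roots_def)
      then have "proj_class v = frame_end (p', w') \<and> z = p' \<and> u = cnj p'"
        by (rule root_multiset_eqD)
          (use p' vzu B frame_end_in_RP1 in \<open>auto simp: frames_def\<close>)
      then have z: "z = p'" and v: "frame_end (p', w') = proj_class v"
        by simp_all
      \<comment> \<open>A representative of a real point is a complex multiple k of a real vector.
        Its real part is that vector times Re k, and Re k is nonzero because \<open>A\<close> omits
        the origin.\<close>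
      then obtain k where "v = k *s vector [of_real (Re (w' * p')), of_real (Re w')]"
        by (auto simp: frame_end_def proj_class_eq_iff)
      moreover have "Re (k * of_real c) = Re k * c" for c
        by simp
      ultimately have k: "(Re (v $ 1), Re (v $ 2)) = (Re k * Re (w' * p'), Re k * Re w')"
        by (simp only: vector_smult_component vector_2)
      let ?x = "frame_of_end ((Re (v $ 1), Re (v $ 2)), p')"
      have x: "?x \<in> U"
        using AB vzu z by (auto simp: N_def)
      have "Re k \<noteq> 0"
        using A0 vzu k by (auto simp: N_def)
      have "vector [of_real (Re (v $ 1)), of_real (Re (v $ 2))] =
          of_real (Re k) *s (vector [of_real (Re (w' * p')), of_real (Re w')] :: complex ^ 2)"
        using k by (simp add: vec_eq_iff forall_2 del: times_complex.sel)
      moreover have "frame_end ?x = proj_class (vector [of_real (Re (v $ 1)), of_real (Re (v $ 2))])"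
        using p'(2) by (intro frame_end_of_end) (simp add: frames_def)
      moreover have "proj_class (of_real (Re k) *s u) = proj_class u" for u :: "complex ^ 2"
        using \<open>Re k \<noteq> 0\<close> by (intro proj_class_smult) simp
      ultimately have "frame_end ?x = frame_end (p', w')"
        by (simp only: frame_end_def prod.case)
      then have "frame_roots ?x = M'"
        using p' by (simp add: frame_roots_def frame_of_end_def)
      with x show "M' \<in> frame_roots ` U"
        by blast
    qed
    ultimately show "\<exists>T. openin root_sets_top T \<and> M \<in> T \<and> T \<subseteq> frame_roots ` U"
      by blast
  qed
qed

lemma quotient_map_frame_roots: "quotient_map (top_of_set frames) root_sets_top frame_roots"
proof (rule continuous_open_imp_quotient_map[OF continuous_frame_roots open_map_frame_roots])
  have "topspace root_sets_top \<subseteq> root_sets"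
    by (simp add: root_sets_top_def)
  then show "frame_roots ` topspace (top_of_set frames) = topspace root_sets_top"
    using continuous_map_image_subset_topspace[OF continuous_frame_roots] frame_roots_image by auto
qed

section \<open>Equivariance and fibres of the root map\<close>

lemma cp1_moebius_proj_class:
  "cp1_moebius A (proj_class v) = proj_class (map_matrix complex_of_real A *v v)"
proof -
  have "proj_class u = (\<lambda>k. k *s u) ` (- {0})" for u :: "complex ^ 2"
    by (auto simp: proj_class_def)
  then show ?thesis
    by (simp add: cp1_moebius_def image_image vector_scalar_commute)
qed

lemma cp1_moebius_vector:
  "cp1_moebius A (proj_class (vector [z, z'])) =
    proj_class (vector [of_real (A $ 1 $ 1) * z + of_real (A $ 1 $ 2) * z',
      of_real (A $ 2 $ 1) * z + of_real (A $ 2 $ 2) * z'])"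
  unfolding cp1_moebius_proj_class
  by (rule arg_cong[where f = proj_class])
    (simp add: vec_eq_iff forall_2 matrix_vector_mult_2 map_matrix_def)

lemma cp1_moebius_cp1_of:
  assumes "of_real (A $ 2 $ 1) * z + of_real (A $ 2 $ 2) \<noteq> (0 :: complex)"
  shows "cp1_moebius A (cp1_of z) = cp1_of (moebius A z)"
  unfolding cp1_of_def cp1_moebius_vector
  by (subst eq_commute, subst proj_class_eq_iff)
    (use assms in \<open>auto simp: vec_eq_iff forall_2 moebius_def
      intro!: exI[of _ "of_real (A $ 2 $ 1) * z + of_real (A $ 2 $ 2)"]\<close>)

lemma moebius_cnj: "moebius A (cnj z) = cnj (moebius A z)"
  by (simp add: moebius_def)

text \<open>As A is real, Re (w (a p + b)) = a Re (w p) + b Re w, and likewise for c and d, so A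
  acts on the vector (Re (w p), Re w) by multiplication. For the other roots, real Moebius maps
  commute with conjugation.\<close>

lemma root_act_frame_roots:
  assumes A: "det A = 1" and x: "x \<in> frames"
  shows "root_act A (frame_roots x) = frame_roots (frame_act A x)"
proof -
  obtain p w where x': "x = (p, w)" "Im p > 0" "w \<noteq> 0"
    using x by (auto simp: frames_def)
  have nz: "of_real (A $ 2 $ 1) * p + of_real (A $ 2 $ 2) \<noteq> (0 :: complex)"
    using automorphy_nonzero[OF A x'(2)] by (simp add: automorphy_def)
  then have "cnj (of_real (A $ 2 $ 1) * p + of_real (A $ 2 $ 2)) \<noteq> 0"
    by (simp only: complex_cnj_zero_iff not_False_eq_True)
  then have nz': "of_real (A $ 2 $ 1) * cnj p + of_real (A $ 2 $ 2) \<noteq> (0 :: complex)"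
    by simp
  have "w * automorphy A p * moebius A p = w * (of_real (A $ 1 $ 1) * p + of_real (A $ 1 $ 2))"
    by (simp only: mult.assoc mult.commute[of "automorphy A p"] moebius_times_automorphy[OF A x'(2)])
  then have "Re (w * automorphy A p * moebius A p) = A $ 1 $ 1 * Re (w * p) + A $ 1 $ 2 * Re w"
    by (simp add: algebra_simps)
  moreover have "Re (w * automorphy A p) = A $ 2 $ 1 * Re (w * p) + A $ 2 $ 2 * Re w"
    by (simp add: automorphy_def algebra_simps)
  ultimately have "cp1_moebius A (frame_end (p, w)) = frame_end (frame_act A (p, w))"
    by (simp only: frame_end_def frame_act_def prod.case cp1_moebius_vector of_real_add of_real_mult)
  then show ?thesis
    by (simp add: x' root_act_def frame_roots_def frame_act_def cp1_moebius_cp1_of nz nz' moebius_cnj)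
qed

lemma frame_roots_eq_iff:
  assumes pw: "(p, w) \<in> frames" and pw': "(p', w') \<in> frames"
  shows "frame_roots (p, w) = frame_roots (p', w') \<longleftrightarrow> p = p' \<and> (\<exists>t::real. t \<noteq> 0 \<and> w' = of_real t * w)"
proof
  assume "frame_roots (p, w) = frame_roots (p', w')"
  then have "{#frame_end (p, w), cp1_of p, cp1_of (cnj p)#} = {#frame_end (p', w'), cp1_of p', cp1_of (cnj p')#}"
    by (simp add: frame_roots_def)
  then have "frame_end (p', w') = frame_end (p, w) \<and> p' = p \<and> cnj p' = cnj p"
    by (rule root_multiset_eqD) (use pw pw' frame_end_in_RP1 in \<open>auto simp: frames_def\<close>)
  then have p: "p' = p" and "frame_end (p, w) = frame_end (p, w')"
    by metis+
  then obtain k where "vector [of_real (Re (w' * p)), of_real (Re w')] =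
      k *s (vector [of_real (Re (w * p)), of_real (Re w)] :: complex ^ 2)"
    unfolding frame_end_def prod.case proj_class_eq_iff by blast
  then have "of_real (Re (w' * p)) = k * of_real (Re (w * p))" "of_real (Re w') = k * of_real (Re w)"
    by (metis vector_2 vector_smult_component)+
  \<comment> \<open>The factor k is complex, but both vectors are real, so Re k serves as
    well.\<close>
  from this[THEN arg_cong[where f = Re]]
  have k: "Re (w' * p) = Re (of_real (Re k) * w * p)" "Re w' = Re (of_real (Re k) * w)"
    by (simp_all add: algebra_simps)
  have "(p, w') = (p, of_real (Re k) * w)"
    using pw frame_of_end_Re[of p w'] frame_of_end_Re[of p "of_real (Re k) * w"]
    by (simp only: k) (simp add: frames_def)
  moreover from this pw' have "Re k \<noteq> 0"
    by (auto simp: frames_def)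
  ultimately show "p = p' \<and> (\<exists>t::real. t \<noteq> 0 \<and> w' = of_real t * w)"
    using p by blast
next
  assume "p = p' \<and> (\<exists>t::real. t \<noteq> 0 \<and> w' = of_real t * w)"
  then obtain t :: real where t: "t \<noteq> 0" "p' = p" "w' = of_real t * w"
    by blast
  have "frame_end (p, w) = frame_end (p, of_real t * w)"
    using t(1) by (auto simp: frame_end_def proj_class_eq_iff vec_eq_iff forall_2 algebra_simps
        intro!: exI[of _ "of_real t"])
  with t show "frame_roots (p, w) = frame_roots (p', w')"
    by (simp add: frame_roots_def)
qed

lemma psl_presentation_root_sets:
  "psl_presentation (top_of_set frames) frame_act root_sets_top root_act frame_roots"
proof (rule psl_presentation_frames[OF quotient_map_frame_roots root_act_frame_roots])
  fix p w assume "(p, w) \<in> frames"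
  moreover from this have "(p, - w) \<in> frames"
    by (simp add: frames_def)
  ultimately show "frame_roots (p, - w) = frame_roots (p, w)"
    by (subst frame_roots_eq_iff) (auto intro!: exI[of _ "-1"])
qed

theorem theorem4p13:
  shows "admits_psl_action Delta_minus_top cubic_act \<and>
    admits_psl_action root_sets_top root_act \<and>
    admits_psl_action UTH_top UTH_act \<and>
    psl_isomorphic Delta_minus_top cubic_act UTH_top UTH_act \<and>
    psl_isomorphic root_sets_top root_act UTH_top UTH_act"
proof (intro conjI)
  show "psl_isomorphic Delta_minus_top cubic_act UTH_top UTH_act"
    by (rule psl_isomorphic_presentations[OF psl_presentation_Delta_minus psl_presentation_UTH])
      (simp add: split_paired_all frame_cubic_class_eq_iff frame_vector_eq_iff)
  show "psl_isomorphic root_sets_top root_act UTH_top UTH_act"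
    by (rule psl_isomorphic_presentations[OF psl_presentation_root_sets psl_presentation_UTH])
      (simp add: split_paired_all frame_roots_eq_iff frame_vector_eq_iff)
qed (use psl_presentation_Delta_minus psl_presentation_root_sets psl_presentation_UTH
    in \<open>auto dest: psl_presentation.admits\<close>)

end
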